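(* For every odd integer $n\geq 7$, the complete graph $K_n$ has a diagram $D$ on $S^2$ with $c(D)=Z(n)$ together with a linear maximal tree $T^L$ of $K_n$ such that no edge diagram of $T^L$ has a crossing in $D$ (so $(D;T^L)$ is a based diagram), and such that $D$ has no free hamiltonian cycle.
   Context: $K_n$ is the complete graph on $n$ vertices (simple, every pair of distinct vertices joined by one edge). A diagram $D$ of a graph on the sphere $S^2$ is a drawing of the graph in which vertices are distinct points and edges are arcs (edge diagrams) joining their endpoints, such that all crossings are transverse double points lying in the interiors of edge diagrams. $c(D)$ denotes the number of crossings of $D$. Set $Z(n)=\frac14\lfloor \frac n2\rfloor\lfloor\frac{n-1}2\rfloor\lfloor\frac{n-2}2\rfloor\lfloor\frac{n-3}2\rfloor$; a diagram $D$ of $K_n$ is called optimal if $c(D)=Z(n)$. A linear maximal tree $T^L$ of $K_n$ is a spanning tree with no vertex of degree $\geq 3$ (i.e. a hamiltonian path). A based diagram $(D;T)$ is a diagram $D$ in which the edge diagrams of the tree $T$ have no crossings. A free hamiltonian cycle of $D$ is a hamiltonian cycle of $K_n$ (a cycle through all vertices) none of whose edge diagrams has a crossing in $D$. *)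

theory Defs
  imports "HOL-Analysis.Analysis"
begin

abbreviation S2 :: "(real^3) set" where
  "S2 \<equiv> sphere 0 1"

definition Kedges :: "nat \<Rightarrow> (nat \<times> nat) set" where
  "Kedges n = {(i,j). i < j \<and> j < n}"

type_synonym diagram = "(nat \<Rightarrow> real^3) \<times> (nat \<Rightarrow> nat \<Rightarrow> real \<Rightarrow> real^3)"

definition arc_int :: "(real \<Rightarrow> real^3) \<Rightarrow> (real^3) set" where
  "arc_int g = path_image g - {pathstart g, pathfinish g}"

definition edge_arc :: "diagram \<Rightarrow> nat \<times> nat \<Rightarrow> real \<Rightarrow> real^3" where
  "edge_arc D a = snd D (fst a) (snd a)"

definition transverse_at :: "(real^3) set \<Rightarrow> (real^3) set \<Rightarrow> real^3 \<Rightarrow> bool" where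
  "transverse_at A B p \<longleftrightarrow>
     (\<exists>U (h :: real^3 \<Rightarrow> real^2) k. openin (top_of_set S2) U \<and> p \<in> U \<and>
        homeomorphism U (ball 0 1) h k \<and> h p = 0 \<and>
        h ` (U \<inter> A) = {x \<in> ball 0 1. x $ 2 = 0} \<and>
        h ` (U \<inter> B) = {x \<in> ball 0 1. x $ 1 = 0})"

definition crossings :: "nat \<Rightarrow> diagram \<Rightarrow> (real^3) set" where
  "crossings n D = {p. \<exists>a \<in> Kedges n. \<exists>b \<in> Kedges n. a \<noteq> b \<and>
      p \<in> arc_int (edge_arc D a) \<and> p \<in> arc_int (edge_arc D b)}"

definition crossing_number :: "nat \<Rightarrow> diagram \<Rightarrow> nat" where
  "crossing_number n D = card (crossings n D)"

definition is_diagram :: "nat \<Rightarrow> diagram \<Rightarrow> bool" where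
  "is_diagram n D \<longleftrightarrow>
     inj_on (fst D) {..<n} \<and> (\<forall>i<n. fst D i \<in> S2) \<and>
     (\<forall>a \<in> Kedges n.
        arc (edge_arc D a) \<and> path_image (edge_arc D a) \<subseteq> S2 \<and>
        pathstart (edge_arc D a) = fst D (fst a) \<and>
        pathfinish (edge_arc D a) = fst D (snd a) \<and>
        (\<forall>k<n. fst D k \<notin> arc_int (edge_arc D a))) \<and>
     (\<forall>a \<in> Kedges n. \<forall>b \<in> Kedges n. a \<noteq> b \<longrightarrow>
        (\<forall>p \<in> arc_int (edge_arc D a) \<inter> arc_int (edge_arc D b).
           transverse_at (path_image (edge_arc D a)) (path_image (edge_arc D b)) p \<and>
           (\<forall>c \<in> Kedges n. c \<noteq> a \<and> c \<noteq> b \<longrightarrow> p \<notin> arc_int (edge_arc D c)))) \<and>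
     finite (crossings n D)"

definition uedge :: "nat \<Rightarrow> nat \<Rightarrow> nat \<times> nat" where
  "uedge i j = (min i j, max i j)"

definition edge_has_crossing :: "nat \<Rightarrow> diagram \<Rightarrow> nat \<times> nat \<Rightarrow> bool" where
  "edge_has_crossing n D a \<longleftrightarrow>
     (\<exists>b \<in> Kedges n. b \<noteq> a \<and> arc_int (edge_arc D a) \<inter> arc_int (edge_arc D b) \<noteq> {})"

text \<open>Z(n) (the division by 4 is exact).\<close>
definition Z :: "nat \<Rightarrow> nat" where
  "Z n = (n div 2) * ((n - 1) div 2) * ((n - 2) div 2) * ((n - 3) div 2) div 4"

text \<open>A hamiltonian path (= linear maximal tree) of K_n, given by the vertex sequence.\<close>
definition ham_path :: "nat \<Rightarrow> nat list \<Rightarrow> bool" where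
  "ham_path n ps \<longleftrightarrow> distinct ps \<and> set ps = {..<n}"

definition path_edges :: "nat list \<Rightarrow> (nat \<times> nat) set" where
  "path_edges ps = {uedge (ps ! k) (ps ! Suc k) | k. Suc k < length ps}"

definition cycle_edges :: "nat list \<Rightarrow> (nat \<times> nat) set" where
  "cycle_edges cs = path_edges cs \<union> {uedge (last cs) (hd cs)}"

definition free_ham_cycle :: "nat \<Rightarrow> diagram \<Rightarrow> nat list \<Rightarrow> bool" where
  "free_ham_cycle n D cs \<longleftrightarrow> ham_path n cs \<and> 3 \<le> n \<and>
     (\<forall>a \<in> cycle_edges cs. \<not> edge_has_crossing n D a)"

end

theory Submission
  imports Defs
begin

text \<open>
  Put the vertices on the equator and draw each edge as the lift, to the upper or the lower hemisphere,
  of the straight chord between its ends. Two edges then cross iff they lie on the same hemisphere and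
  their ends alternate along the equator. If the parameters of the equatorial points are generic, no three chords
  are concurrent, so that crossings are counted by pairs of alternating chords.

  Let \<open>n = 2 m + 1\<close> and put \<open>{i, j}\<close> on the lower page iff \<open>(i + j) mod n < m\<close>. This is an
  optimal two-page drawing. Now reroute the edge \<open>{0, m}\<close>: it starts from \<open>0\<close> on the upper page, crosses the
  equator between \<open>m + 1\<close> and \<open>m + 2\<close> and reaches \<open>m\<close> on the lower page. The number of crossings of
  this edge does not change, but it now crosses \<open>{m + 1, m + 2}\<close>, while the other equatorial edges stay free
  and form a hamiltonian path. For \<open>m \<ge> 4\<close> the vertex \<open>m + 1\<close> has only one free edge; for \<open>m = 3\<close>
  the four vertices \<open>0, 2, 4, 5\<close> are pairwise joined by edges with crossings, and a 7-cycle has no four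
  independent vertices.
\<close>

section \<open>Chords on the sphere\<close>

text \<open>Rational parametrisation of the circle by the tangent of the half angle. It misses only
  the point -1, and increasing parameters follow the cyclic order, so the order of the reals stands
  for the order along the equator.\<close>

definition circ :: "real \<Rightarrow> complex" where
  "circ u = Complex ((1 - u\<^sup>2) / (1 + u\<^sup>2)) (2 * u / (1 + u\<^sup>2))"

text \<open>An equation of the line through \<open>circ u\<close> and \<open>circ v\<close>, or of
  the tangent if \<open>u = v\<close>, normalised so that its values on the circle factor as in
  \<open>lin_circ\<close>.\<close>

definition lin :: "real \<Rightarrow> real \<Rightarrow> complex \<Rightarrow> real" where
  "lin u v z = (1 - u * v) * Re z + (u + v) * Im z - (1 + u * v)"

definition shadow :: "real^3 \<Rightarrow> complex" where
  "shadow q = Complex (q $ 1) (q $ 2)"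

definition lift :: "real \<Rightarrow> complex \<Rightarrow> real^3" where
  "lift s z = vector [Re z, Im z, s * sqrt (1 - (cmod z)\<^sup>2)]"

text \<open>The strict inequality selects the hemisphere and also leaves out the two ends, which lie
  on the equator.\<close>

definition chord :: "real \<Rightarrow> real \<Rightarrow> real \<Rightarrow> (real^3) set" where
  "chord s u v = {q \<in> S2. s * q $ 3 > 0 \<and> lin u v (shadow q) = 0}"

lemma denom_pos [simp]: "1 + (u::real)\<^sup>2 > 0" "1 + u\<^sup>2 \<noteq> 0"
  by (auto simp: add_pos_nonneg add_nonneg_eq_0_iff)

lemma cmod_circ [simp]: "cmod (circ u) = 1"
proof -
  have "(1 - u\<^sup>2)\<^sup>2 + (2 * u)\<^sup>2 = (1 + u\<^sup>2)\<^sup>2" by algebra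
  then have "((1 - u\<^sup>2) / (1 + u\<^sup>2))\<^sup>2 + (2 * u / (1 + u\<^sup>2))\<^sup>2 = 1"
    by (simp add: power_divide flip: add_divide_distrib)
  then show ?thesis by (simp add: circ_def cmod_def)
qed

lemma lin_circ: "lin u v (circ w) = - 2 * (w - u) * (w - v) / (1 + w\<^sup>2)"
proof -
  have "(1 - u * v) * (1 - w\<^sup>2) + (u + v) * (2 * w) - (1 + u * v) * (1 + w\<^sup>2)
     = - 2 * (w - u) * (w - v)" by algebra
  moreover have "lin u v (circ w) = ((1 - u * v) * (1 - w\<^sup>2) + (u + v) * (2 * w) - (1 + u * v) * (1 + w\<^sup>2)) / (1 + w\<^sup>2)"
    by (simp add: lin_def circ_def divide_simps)
  ultimately show ?thesis by metis
qed

lemma lin_affine: "lin u v ((1 - l) *\<^sub>R a + l *\<^sub>R b) = (1 - l) * lin u v a + l * lin u v b"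
  by (simp add: lin_def algebra_simps)

text \<open>The tangent \<open>lin u u\<close> touches the circle only at
  \<open>circ u\<close>.\<close>

lemma circ_inj: "circ u = circ v \<Longrightarrow> u = v"
  using lin_circ[of u u v] lin_circ[of u u u] by (auto simp: divide_simps)

lemma norm_affine_circ:
  "(cmod ((1 - l) *\<^sub>R circ u + l *\<^sub>R circ v))\<^sup>2 = 1 - l * (1 - l) * (cmod (circ v - circ u))\<^sup>2"
proof -
  have "(Re (circ w))\<^sup>2 + (Im (circ w))\<^sup>2 = 1" for w
    using cmod_circ[of w] by (metis cmod_power2 power_one)
  from this[of u] this[of v] show ?thesis
    unfolding cmod_power2 by (simp, algebra)
qed

text \<open>The gradients of the tangent \<open>lin u u\<close> and of the secant
  \<open>lin u v\<close> have determinant \<open>(v - u) * (1 + u\<^sup>2)\<close>, so the two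
  values determine a point of the plane.\<close>

lemma lin_zero_affine:
  assumes "u \<noteq> v" "lin u v z = 0"
  obtains l where "z = (1 - l) *\<^sub>R circ u + l *\<^sub>R circ v"
proof -
  \<comment> \<open>Chosen so that the tangent form, which vanishes at \<open>circ u\<close>, takes
    the same value at \<open>w\<close> as at \<open>z\<close>.\<close>
  define l where "l = lin u u z / lin u u (circ v)"
  define w where "w = (1 - l) *\<^sub>R circ u + l *\<^sub>R circ v"
  have "lin u u (circ v) \<noteq> 0" using assms by (simp add: lin_circ)
  then have 1: "lin u u w = lin u u z" by (simp add: w_def lin_affine lin_circ l_def)
  have 2: "lin u v w = lin u v z" using assms by (simp add: w_def lin_affine lin_circ)
  have A: "(1 - u * u) * (Re w - Re z) + (u + u) * (Im w - Im z) = 0"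
    using 1 unfolding lin_def by (simp add: algebra_simps)
  have B: "(1 - u * v) * (Re w - Re z) + (u + v) * (Im w - Im z) = 0"
    using 2 unfolding lin_def by (simp add: algebra_simps)
  have "(v - u) * (1 + u\<^sup>2) * (Re w - Re z) =
      (u + v) * ((1 - u * u) * (Re w - Re z) + (u + u) * (Im w - Im z))
    - 2 * u * ((1 - u * v) * (Re w - Re z) + (u + v) * (Im w - Im z))"
    by algebra
  moreover have "(v - u) * (1 + u\<^sup>2) * (Im w - Im z) =
      (1 - u * u) * ((1 - u * v) * (Re w - Re z) + (u + v) * (Im w - Im z))
    - (1 - u * v) * ((1 - u * u) * (Re w - Re z) + (u + u) * (Im w - Im z))"
    by algebra
  ultimately have "(v - u) * (1 + u\<^sup>2) * (Re w - Re z) = 0" "(v - u) * (1 + u\<^sup>2) * (Im w - Im z) = 0"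
    unfolding A B by simp_all
  then have "w = z" using assms by (simp add: complex_eq_iff)
  then show thesis using that w_def by blast
qed

lemma shadow_lift [simp]: "shadow (lift s z) = z"
  by (simp add: shadow_def lift_def complex_eq_iff)

lemma mem_S2: "q \<in> S2 \<longleftrightarrow> (cmod (shadow q))\<^sup>2 + (q $ 3)\<^sup>2 = 1"
  by (simp add: norm_eq_1 inner_vec_def sum_3 shadow_def cmod_power2 flip: power2_eq_square)

lemma lift_3: "lift s z $ 3 = s * sqrt (1 - (cmod z)\<^sup>2)"
  by (simp add: lift_def)

lemma lift_in_S2:
  assumes "s = 1 \<or> s = -1" "cmod z \<le> 1"
  shows "lift s z \<in> S2"
proof -
  have "(cmod z)\<^sup>2 \<le> 1" using assms by (simp add: power_le_one)
  then show ?thesis unfolding mem_S2 using assms by (auto simp: lift_3)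
qed

lemma lift_shadow:
  assumes "s = 1 \<or> s = -1" "q \<in> S2" "s * q $ 3 \<ge> 0"
  shows "lift s (shadow q) = q"
proof -
  have "1 - (cmod (shadow q))\<^sup>2 = (q $ 3)\<^sup>2" using assms(2) unfolding mem_S2 by simp
  then have "sqrt (1 - (cmod (shadow q))\<^sup>2) = \<bar>q $ 3\<bar>" by simp
  then have "lift s (shadow q) $ 3 = q $ 3" using assms by (auto simp: lift_3)
  then show ?thesis by (simp add: vec_eq_iff forall_3 lift_def shadow_def)
qed

lemma cmod_shadow_less: "q \<in> S2 \<Longrightarrow> s * q $ 3 > 0 \<Longrightarrow> cmod (shadow q) < 1"
proof -
  assume q: "q \<in> S2" "s * q $ 3 > 0"
  then have "(q $ 3)\<^sup>2 > 0" by auto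
  then have "(cmod (shadow q))\<^sup>2 < 1" using q(1) unfolding mem_S2 by linarith
  then show ?thesis by (simp add: abs_square_less_1)
qed

lemma lift_3_pos:
  assumes "s = 1 \<or> s = -1" "cmod z < 1"
  shows "s * lift s z $ 3 > 0"
proof -
  have "(cmod z)\<^sup>2 < 1" using assms by (simp add: abs_square_less_1)
  then show ?thesis using assms by (auto simp: lift_3)
qed

text \<open>By \<open>norm_affine_circ\<close>, a point of the line lies in the open disc iff
  \<open>l * (1 - l) > 0\<close>; over the open disc \<open>lift\<close> inverts the projection
  \<open>shadow\<close>.\<close>

lemma chord_affine:
  assumes "s = 1 \<or> s = -1" "u \<noteq> v"
  shows "q \<in> chord s u v \<longleftrightarrow> (\<exists>l. 0 < l \<and> l < 1 \<and> q = lift s ((1 - l) *\<^sub>R circ u + l *\<^sub>R circ v))"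
proof
  have pos: "(cmod (circ v - circ u))\<^sup>2 > 0" using assms circ_inj[of v u] by auto
  { assume q: "q \<in> chord s u v"
    then obtain l where l: "shadow q = (1 - l) *\<^sub>R circ u + l *\<^sub>R circ v"
      using lin_zero_affine[OF assms(2)] unfolding chord_def by blast
    have "cmod (shadow q) < 1" using q cmod_shadow_less by (auto simp: chord_def)
    then have "(cmod (shadow q))\<^sup>2 < 1" by (simp add: abs_square_less_1)
    then have "0 < l * (1 - l) * (cmod (circ v - circ u))\<^sup>2"
      unfolding l norm_affine_circ by simp
    then have "0 < l * (1 - l)" using pos by (simp add: zero_less_mult_iff)
    then have "0 < l \<and> l < 1" by (auto simp: zero_less_mult_iff)
    moreover have "q = lift s (shadow q)" using q assms lift_shadow by (force simp: chord_def)
    ultimately show "\<exists>l. 0 < l \<and> l < 1 \<and> q = lift s ((1 - l) *\<^sub>R circ u + l *\<^sub>R circ v)"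
      using l by auto }
  assume "\<exists>l. 0 < l \<and> l < 1 \<and> q = lift s ((1 - l) *\<^sub>R circ u + l *\<^sub>R circ v)"
  then obtain l where l: "0 < l" "l < 1" "q = lift s ((1 - l) *\<^sub>R circ u + l *\<^sub>R circ v)" by blast
  let ?z = "(1 - l) *\<^sub>R circ u + l *\<^sub>R circ v"
  have "0 < l * (1 - l) * (cmod (circ v - circ u))\<^sup>2" using l pos by simp
  then have "(cmod ?z)\<^sup>2 < 1" unfolding norm_affine_circ by simp
  then have *: "cmod ?z < 1" by (simp add: abs_square_less_1)
  have "lin u v ?z = 0" unfolding lin_affine by (simp add: lin_circ)
  then show "q \<in> chord s u v"
    using * lift_in_S2[OF assms(1), of ?z] lift_3_pos[OF assms(1), of ?z] l(3) by (simp add: chord_def)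
qed

section \<open>When two chords meet\<close>

lemma affine_root:
  fixes a b :: real
  assumes "0 < l" "l < 1" "(1 - l) * a + l * b = 0"
  shows "a * b < 0 \<or> a = 0 \<and> b = 0"
  using assms
  by (smt (verit) mult_eq_0_iff mult_less_0_iff mult_neg_neg mult_pos_pos mult_pos_neg)

lemma lin_circ_mult_sign:
  "lin u v (circ w) * lin u v (circ x) < 0 \<longleftrightarrow> (w - u) * (w - v) * ((x - u) * (x - v)) < 0"
proof -
  have "lin u v (circ w) * lin u v (circ x) = 4 / ((1 + w\<^sup>2) * (1 + x\<^sup>2)) * ((w - u) * (w - v) * ((x - u) * (x - v)))"
  proof -
    have "- 2 * (w - u) * (w - v) * (- 2 * (x - u) * (x - v)) = 4 * ((w - u) * (w - v) * ((x - u) * (x - v)))"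
      by algebra
    then show ?thesis unfolding lin_circ times_divide_times_eq by (simp only: times_divide_eq_left)
  qed
  moreover have "4 / ((1 + w\<^sup>2) * (1 + x\<^sup>2)) > 0" by simp
  moreover have "c * r < 0 \<longleftrightarrow> r < 0" if "c > 0" for c r :: real
    using that by (simp add: mult_less_0_iff)
  ultimately show ?thesis by presburger
qed

text \<open>At a common point \<open>lin u' v'\<close> vanishes strictly between the ends of the
  first chord. So these ends lie strictly on opposite sides of the second line, or both on it, and
  then the chords coincide.\<close>

lemma chords_meet_imp:
  assumes "s = 1 \<or> s = -1" "u < v" "u' < v'" "(u, v) \<noteq> (u', v')"
    and "q \<in> chord s u v" "q \<in> chord s u' v'"
  shows "u < u' \<and> u' < v \<and> v < v' \<or> u' < u \<and> u < v' \<and> v' < v"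
proof -
  obtain l where l: "0 < l" "l < 1" "q = lift s ((1 - l) *\<^sub>R circ u + l *\<^sub>R circ v)"
    using assms chord_affine[of s u v] by auto
  have "(1 - l) * lin u' v' (circ u) + l * lin u' v' (circ v) = 0"
    using assms(6) l(3) by (simp add: chord_def flip: lin_affine)
  from affine_root[OF l(1,2) this]
  show ?thesis
  proof
    assume "lin u' v' (circ u) * lin u' v' (circ v) < 0"
    then have *: "(u - u') * (u - v') * ((v - u') * (v - v')) < 0" by (simp only: lin_circ_mult_sign)
    show ?thesis using * assms(2,3) by (auto simp: mult_less_0_iff zero_less_mult_iff)
  next
    assume "lin u' v' (circ u) = 0 \<and> lin u' v' (circ v) = 0"
    then have "(u = u' \<or> u = v') \<and> (v = u' \<or> v = v')" by (auto simp: lin_circ)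
    then show ?thesis using assms by auto
  qed
qed

text \<open>Along the first chord \<open>lin u' v'\<close> is affine in \<open>l\<close>, negative
  at one end and positive at the other, so it has exactly one zero.\<close>

lemma chords_meet:
  assumes "s = 1 \<or> s = -1" "u < u'" "u' < v" "v < v'"
  shows "\<exists>!q. q \<in> chord s u v \<and> q \<in> chord s u' v'"
proof -
  let ?a = "lin u' v' (circ u)" and ?b = "lin u' v' (circ v)"
  have a: "?a < 0" using assms by (simp add: lin_circ divide_simps zero_less_mult_iff mult_less_0_iff)
  have b: "?b > 0" using assms by (simp add: lin_circ divide_simps zero_less_mult_iff mult_less_0_iff)
  have mem: "q \<in> chord s u v \<and> q \<in> chord s u' v' \<longleftrightarrow>
      (\<exists>l. 0 < l \<and> l < 1 \<and> (1 - l) * ?a + l * ?b = 0 \<and> q = lift s ((1 - l) *\<^sub>R circ u + l *\<^sub>R circ v))" (is "?L \<longleftrightarrow> ?R") for q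
  proof
    assume ?L
    then obtain l where l: "0 < l" "l < 1" "q = lift s ((1 - l) *\<^sub>R circ u + l *\<^sub>R circ v)"
      using assms chord_affine[of s u v] by auto
    moreover have "(1 - l) * ?a + l * ?b = 0"
      using \<open>?L\<close> l(3) by (simp add: chord_def flip: lin_affine)
    ultimately show ?R by blast
  next
    assume ?R
    then obtain l where l: "0 < l" "l < 1" "(1 - l) * ?a + l * ?b = 0" "q = lift s ((1 - l) *\<^sub>R circ u + l *\<^sub>R circ v)" by blast
    have "q \<in> chord s u v" using chord_affine[of s u v q] assms l by auto
    moreover have "lin u' v' (shadow q) = 0" using l(3) by (simp add: l(4) lin_affine)
    ultimately show ?L by (simp add: chord_def)
  qed
  define l where "l = - ?a / (?b - ?a)"
  have "(1 - l') * ?a + l' * ?b = 0 \<longleftrightarrow> l' = l" for l'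
    using a b by (auto simp: l_def field_simps)
  moreover have "0 < l" "l < 1" using a b by (auto simp: l_def divide_simps)
  ultimately show ?thesis unfolding mem by auto
qed

text \<open>The last factor is the determinant of the gradients of \<open>lin u v\<close> and
  \<open>lin u' v'\<close>. Distinct values at the ends of a chord therefore show that the lines are
  not parallel.\<close>

lemma lin_slope:
  "lin u' v' (circ v) - lin u' v' (circ u) =
     2 * (v - u) / ((1 + u\<^sup>2) * (1 + v\<^sup>2)) * ((1 - u * v) * (u' + v') - (1 - u' * v') * (u + v))"
proof -
  have *: "- 2 * (v - u') * (v - v') * (1 + u\<^sup>2) - - 2 * (u - u') * (u - v') * (1 + v\<^sup>2)
      = 2 * (v - u) * ((1 - u * v) * (u' + v') - (1 - u' * v') * (u + v))" by algebra
  show ?thesis unfolding lin_circ diff_frac_eq[OF denom_pos(2) denom_pos(2)] *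
    by (simp add: mult.commute)
qed

lemma chords_not_parallel:
  fixes u v u' v' :: real
  assumes "u < u'" "u' < v" "v < v'"
  shows "(1 - u * v) * (u' + v') - (1 - u' * v') * (u + v) \<noteq> 0"
proof -
  have "lin u' v' (circ u) < 0" "lin u' v' (circ v) > 0"
    using assms by (simp_all add: lin_circ divide_simps zero_less_mult_iff mult_less_0_iff)
  then show ?thesis using lin_slope[of u' v' v u] by fastforce
qed

section \<open>Local charts at a crossing\<close>

lemma continuous_on_vector3 [continuous_intros]:
  fixes f g h :: "'a::topological_space \<Rightarrow> real"
  assumes "continuous_on S f" "continuous_on S g" "continuous_on S h"
  shows "continuous_on S (\<lambda>x. vector [f x, g x, h x] :: real^3)"
proof -
  have "(\<lambda>x. vector [f x, g x, h x] :: real^3) = (\<lambda>x. f x *\<^sub>R axis 1 1 + g x *\<^sub>R axis 2 1 + h x *\<^sub>R axis 3 1)"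
    by (simp add: fun_eq_iff vec_eq_iff forall_3 axis_def)
  then show ?thesis by (simp only:) (intro continuous_intros assms)
qed

lemma continuous_on_vector2 [continuous_intros]:
  fixes f g :: "'a::topological_space \<Rightarrow> real"
  assumes "continuous_on S f" "continuous_on S g"
  shows "continuous_on S (\<lambda>x. vector [f x, g x] :: real^2)"
proof -
  have "(\<lambda>x. vector [f x, g x] :: real^2) = (\<lambda>x. f x *\<^sub>R axis 1 1 + g x *\<^sub>R axis 2 1)"
    by (simp add: fun_eq_iff vec_eq_iff forall_2 axis_def)
  then show ?thesis by (simp only:) (intro continuous_intros assms)
qed

lemma continuous_on_lift [continuous_intros]:
  "continuous_on S f \<Longrightarrow> continuous_on S (\<lambda>x. lift s (f x))"
  unfolding lift_def by (intro continuous_intros)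

lemma continuous_on_lin_shadow [continuous_intros]:
  "continuous_on S (\<lambda>q. lin u v (shadow q))"
  unfolding lin_def shadow_def by (simp, intro continuous_intros)

text \<open>Since the gradients are independent, the two linear forms of the projected point are
  affine coordinates of the plane. Suitably scaled they form the chart \<open>h\<close>; its inverse
  \<open>k\<close> is an affine map followed by \<open>lift\<close>.\<close>

lemma transverse_chords:
  fixes u v u' v' :: real
  assumes s: "s = 1 \<or> s = -1"
    and det: "(1 - u * v) * (u' + v') - (1 - u' * v') * (u + v) \<noteq> 0"
    and q: "q \<in> chord s u v" "q \<in> chord s u' v'"
    and A: "A \<inter> {p. s * p $ 3 > 0} = chord s u v"
    and B: "B \<inter> {p. s * p $ 3 > 0} = chord s u' v'"
  shows "transverse_at A B q"
proof -
  define d where "d = (1 - u * v) * (u' + v') - (1 - u' * v') * (u + v)"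
  have d: "d \<noteq> 0" using det by (simp add: d_def)
  define z where "z = shadow q"
  have z0: "lin u v z = 0" "lin u' v' z = 0" using q by (auto simp: chord_def z_def)
  have zq: "q = lift s z" using q lift_shadow[OF s, of q] by (auto simp: chord_def z_def)
  have z1: "cmod z < 1" using q cmod_shadow_less by (auto simp: chord_def z_def)
  \<comment> \<open>The inverse of the linear part of the pair of forms. \<open>lin u v\<close> goes
    with the second coordinate because \<open>transverse_at\<close> sends the first set to
    \<open>x $ 2 = 0\<close>.\<close>
  define N :: "real^2 \<Rightarrow> complex" where
    "N y = Complex (((u' + v') * y $ 2 - (u + v) * y $ 1) / d)
                   (((1 - u * v) * y $ 1 - (1 - u' * v') * y $ 2) / d)" for y
  have linN: "(1 - u * v) * Re (N y) + (u + v) * Im (N y) = y $ 2"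
       "(1 - u' * v') * Re (N y) + (u' + v') * Im (N y) = y $ 1" for y
    using d by (simp_all add: N_def field_simps) (simp_all add: d_def algebra_simps)
  have contN: "continuous_on S N" for S
    unfolding N_def by (intro continuous_intros) (simp_all add: d)
  \<comment> \<open>A bound for \<open>N\<close> on the unit ball; the summand 1 makes it positive
    at once.\<close>
  define c where "c = norm (u' + v') / \<bar>d\<bar> + norm (u + v) / \<bar>d\<bar> + norm (1 - u * v) / \<bar>d\<bar> + norm (1 - u' * v') / \<bar>d\<bar> + 1"
  have c: "c > 0" unfolding c_def by (intro add_nonneg_pos add_nonneg_nonneg) auto
  have Nc: "cmod (N y) \<le> c" if "norm y < 1" for y
  proof -
    have y: "\<bar>y $ 1\<bar> \<le> 1" "\<bar>y $ 2\<bar> \<le> 1"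
      using that component_le_norm_cart[of y 1] component_le_norm_cart[of y 2] by auto
    have *: "\<bar>a * x / d\<bar> \<le> \<bar>a\<bar> / \<bar>d\<bar>" if "\<bar>x\<bar> \<le> 1" for a x :: real
      using that d by (simp add: abs_mult divide_simps mult_left_le)
    have sum_bound: "\<bar>a - b\<bar> + \<bar>a' - b'\<bar> \<le> A + B + A' + B' + 1"
      if "\<bar>a\<bar> \<le> A" "\<bar>b\<bar> \<le> B" "\<bar>a'\<bar> \<le> A'" "\<bar>b'\<bar> \<le> B'" for a b a' b' A B A' B' :: real
      using abs_triangle_ineq4[of a b] abs_triangle_ineq4[of a' b'] that by simp
    have "cmod (N y) \<le> \<bar>Re (N y)\<bar> + \<bar>Im (N y)\<bar>" by (rule cmod_le)
    also have "\<dots> \<le> c"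
      unfolding N_def c_def complex.sel diff_divide_distrib real_norm_def
      by (rule sum_bound; rule *; rule y)
    finally show ?thesis .
  qed
  \<comment> \<open>At this scale \<open>w\<close> moves by at most half the distance from
    \<open>z\<close> to the unit circle, so its values can be lifted to the open hemisphere.\<close>
  define e where "e = (1 - cmod z) / (2 * c)"
  have e: "e > 0" using z1 c by (simp add: e_def)
  define w where "w y = z + e *\<^sub>R N y" for y
  have w1: "cmod (w y) < 1" if "norm y < 1" for y
  proof -
    have 1: "cmod (w y) \<le> cmod z + e * cmod (N y)"
      unfolding w_def using norm_triangle_ineq[of z "e *\<^sub>R N y"] e by simp
    have 2: "e * cmod (N y) \<le> e * c" using Nc[OF that] e by simp
    have 3: "e * c = (1 - cmod z) / 2" using c by (simp add: e_def)
    have "cmod (w y) \<le> cmod z + (1 - cmod z) / 2" using 1 2 unfolding 3 by (rule order.trans[OF _ add_left_mono])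
    also have "\<dots> = (cmod z + 1) / 2" by (simp add: field_simps)
    finally show ?thesis using z1 by simp
  qed
  have linw: "lin u v (w y) = e * y $ 2" "lin u' v' (w y) = e * y $ 1" for y
  proof -
    have "lin u v (w y) = lin u v z + e * ((1 - u * v) * Re (N y) + (u + v) * Im (N y))"
      by (simp add: lin_def w_def algebra_simps)
    then show "lin u v (w y) = e * y $ 2" by (simp add: z0 linN)
    have "lin u' v' (w y) = lin u' v' z + e * ((1 - u' * v') * Re (N y) + (u' + v') * Im (N y))"
      by (simp add: lin_def w_def algebra_simps)
    then show "lin u' v' (w y) = e * y $ 1" by (simp add: z0 linN)
  qed
  define h :: "real^3 \<Rightarrow> real^2" where
    "h p = vector [lin u' v' (shadow p) / e, lin u v (shadow p) / e]" for p
  define k where "k y = lift s (w y)" for y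
  define U where "U = {p \<in> S2. s * p $ 3 > 0 \<and> norm (h p) < 1}"
  have conth: "continuous_on S h" for S
    unfolding h_def using e by (intro continuous_intros) auto
  have hk: "h (k y) = y" for y
    using e by (simp add: h_def k_def linw vec_eq_iff forall_2)
  have kU: "k y \<in> U" if "norm y < 1" for y
    using that w1[OF that] lift_in_S2[OF s, of "w y"] lift_3_pos[OF s, of "w y"] hk[of y]
    by (simp add: U_def k_def)
  have kh: "k (h p) = p" if "p \<in> U" for p
  proof -
    have 1: "lin u v (w (h p)) = lin u v (shadow p)" "lin u' v' (w (h p)) = lin u' v' (shadow p)"
      using e by (simp_all add: linw) (simp_all add: h_def)
    let ?X = "Re (w (h p)) - Re (shadow p)" and ?Y = "Im (w (h p)) - Im (shadow p)"
    have "(1 - u * v) * ?X + (u + v) * ?Y = 0" "(1 - u' * v') * ?X + (u' + v') * ?Y = 0"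
      using 1 by (simp_all add: lin_def algebra_simps)
    moreover have "d * ?X = (u' + v') * ((1 - u * v) * ?X + (u + v) * ?Y) - (u + v) * ((1 - u' * v') * ?X + (u' + v') * ?Y)"
      "d * ?Y = (1 - u * v) * ((1 - u' * v') * ?X + (u' + v') * ?Y) - (1 - u' * v') * ((1 - u * v) * ?X + (u + v) * ?Y)"
      unfolding d_def by algebra+
    ultimately have "d * ?X = 0" "d * ?Y = 0" by simp_all
    then have "w (h p) = shadow p" using d by (simp add: complex_eq_iff)
    then show ?thesis using that lift_shadow[OF s, of p] by (simp add: k_def U_def)
  qed
  have U_Int: "U = S2 \<inter> {p. s * p $ 3 > 0 \<and> norm (h p) < 1}" by (auto simp: U_def)
  have "open {p. s * p $ 3 > 0 \<and> norm (h p) < 1}"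
  proof (intro open_Collect_conj open_Collect_less continuous_on_const)
    show "continuous_on UNIV (\<lambda>p :: real^3. s * p $ 3)" by (intro continuous_intros)
    show "continuous_on UNIV (\<lambda>p. norm (h p))" by (rule continuous_on_norm[OF conth])
  qed
  then have op: "openin (top_of_set S2) U" unfolding U_Int by (rule openin_open_Int)
  have h0: "h q = 0" by (simp add: h_def vec_eq_iff forall_2 z0 flip: z_def)
  have qU: "q \<in> U" using q h0 by (simp add: U_def chord_def)
  have hom: "homeomorphism U (ball 0 1) h k"
  proof (rule homeomorphismI)
    show "continuous_on U h" by (rule conth)
    show "continuous_on (ball 0 1) k"
      unfolding k_def w_def by (intro continuous_intros contN)
    show "h ` U \<subseteq> ball 0 1" by (auto simp: U_def)
    show "k ` ball 0 1 \<subseteq> U" using kU by auto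
  qed (use hk kh in auto)
  have im: "h ` (U \<inter> X) = {x \<in> ball 0 1. x $ i = 0}"
    if X: "\<And>p. p \<in> U \<Longrightarrow> p \<in> X \<longleftrightarrow> h p $ i = 0" for X i
  proof -
    have "x \<in> h ` (U \<inter> X)" if "norm x < 1" "x $ i = 0" for x
      using that kU[OF that(1)] X[of "k x"] hk[of x] by (metis IntI image_eqI)
    then show ?thesis using X by (auto simp: U_def)
  qed
  have pA: "p \<in> A \<longleftrightarrow> h p $ 2 = 0" if "p \<in> U" for p
  proof -
    have "p \<in> A \<longleftrightarrow> p \<in> chord s u v" using that unfolding A[symmetric] by (simp add: U_def)
    then show ?thesis using that e by (simp add: U_def chord_def h_def)
  qed
  have pB: "p \<in> B \<longleftrightarrow> h p $ 1 = 0" if "p \<in> U" for p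
  proof -
    have "p \<in> B \<longleftrightarrow> p \<in> chord s u' v'" using that unfolding B[symmetric] by (simp add: U_def)
    then show ?thesis using that e by (simp add: U_def chord_def h_def)
  qed
  show ?thesis unfolding transverse_at_def
    by (intro exI conjI, rule op, rule qU, rule hom, rule h0, rule im, erule pA, rule im, erule pB)
qed

text \<open>
  Up to sign, the determinant with rows \<open>(1, a + b, a b)\<close>, \<open>(1, c + d, c d)\<close>, \<open>(1, e + f, e f)\<close>. These rows
  are the coefficients of \<^const>\<open>lin\<close> in the basis \<open>Re z - 1\<close>, \<open>Im z\<close>, \<open>- (1 + Re z)\<close>.
\<close>

definition concur :: "real \<Rightarrow> real \<Rightarrow> real \<Rightarrow> real \<Rightarrow> real \<Rightarrow> real \<Rightarrow> real" where
  "concur a b c d e f = ((c + d) * (e * f) - (e + f) * (c * d)) - ((a + b) * (e * f) - (e + f) * (a * b))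
      + ((a + b) * (c * d) - (c + d) * (a * b))"

section \<open>Generic positions on the circle\<close>

lemma concur_zero:
  assumes "lin a b z = 0" "lin c d z = 0" "lin e f z = 0"
  shows "concur a b c d e f = 0"
proof -
  \<comment> \<open>Cramer's rule: \<open>(Re z - 1, Im z, - (1 + Re z))\<close> is in the kernel of
    the matrix, and its first and third entries cannot both be zero.\<close>
  have "(Re z - 1) * concur a b c d e f = 0" "(Re z + 1) * concur a b c d e f = 0"
    using assms unfolding lin_def concur_def by algebra+
  then show ?thesis by auto
qed

lemma concur_perm:
  "concur a b c d e f = - concur a b e f c d"
  "concur a b c d e f = - concur c d a b e f"
  "concur a b c d e f = concur b a c d e f"
  "concur a b c d e f = concur a b d c e f"
  "concur a b c d e f = concur a b c d f e"
  unfolding concur_def by algebra+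

text \<open>\<open>concur\<close> is affine in its last argument. If both coefficients vanished,
  \<open>{a, b}\<close> and \<open>{c, d}\<close> would have equal sums and equal products and hence
  coincide; so there is at most one zero.\<close>

lemma finite_concur_zero:
  assumes "a \<noteq> c" "a \<noteq> d" "e \<noteq> a" "e \<noteq> b"
  shows "finite {x. concur a b c d e x = 0}"
proof -
  define S where "S = {x. concur a b c d e x = 0}"
  define p where "p = (c + d) * e - c * d - ((a + b) * e - a * b)"
  define r where "r = (a + b) * (c * d) - (c + d) * (a * b) - e * (c * d) + e * (a * b)"
  have *: "concur a b c d e x = x * p + r" for x
    unfolding concur_def p_def r_def by algebra
  have "p \<noteq> 0 \<or> r \<noteq> 0"
  proof (rule ccontr)
    assume "\<not> ?thesis"
    then have "p = 0" "r = 0" by auto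
    then have "(a + b - c - d) * ((e - a) * (e - b)) = 0"
      unfolding p_def r_def by algebra
    then have 1: "a + b = c + d" using assms by auto
    then have "a * b = c * d" using \<open>p = 0\<close> by (simp add: p_def)
    then have "(a - c) * (a - d) = 0" using 1 by algebra
    then show False using assms by auto
  qed
  then have "x = y" if "x \<in> S" "y \<in> S" for x y
    using that unfolding S_def * by (simp add: eq_neg_iff_add_eq_0) (metis (no_types) add_right_cancel mult_cancel_right mult_zero_right add_0)
  then have "S \<subseteq> {SOME x. x \<in> S}" by (metis singletonI someI subsetI)
  then show ?thesis unfolding S_def by (rule finite_subset) simp
qed

text \<open>Any five earlier parameters exclude finitely many values of the next one, which is taken
  above all excluded values and all earlier parameters. \<open>concur_perm\<close> moves it to the
  last place.\<close>

lemma generic_sequence: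
  "\<exists>t :: nat \<Rightarrow> real. (\<forall>i j. i < j \<longrightarrow> j < N \<longrightarrow> t i < t j) \<and>
     (\<forall>a b c d e f. distinct [a, b, c, d, e, f] \<longrightarrow> {a, b, c, d, e, f} \<subseteq> {..<N} \<longrightarrow>
        concur (t a) (t b) (t c) (t d) (t e) (t f) \<noteq> 0)"
proof (induction N)
  case 0
  then show ?case by auto
next
  case (Suc N)
  then obtain t :: "nat \<Rightarrow> real" where
    t: "\<And>i j. i < j \<Longrightarrow> j < N \<Longrightarrow> t i < t j" and
    g: "\<And>a b c d e f. distinct [a, b, c, d, e, f] \<Longrightarrow> {a, b, c, d, e, f} \<subseteq> {..<N} \<Longrightarrow>
        concur (t a) (t b) (t c) (t d) (t e) (t f) \<noteq> 0" by blast
  have inj: "t i \<noteq> t j" if "i \<noteq> j" "i < N" "j < N" for i j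
    using t[of i j] t[of j i] that by (cases i j rule: linorder_cases) auto
  define J where "J = {(a, b, c, d, e). distinct [a, b, c, d, e] \<and> {a, b, c, d, e} \<subseteq> {..<N}}"
  define Bad where "Bad = (\<Union>(a, b, c, d, e) \<in> J. {x. concur (t a) (t b) (t c) (t d) (t e) x = 0})"
  have "J \<subseteq> {..<N} \<times> {..<N} \<times> {..<N} \<times> {..<N} \<times> {..<N}" by (auto simp: J_def)
  then have "finite J" by (rule finite_subset) auto
  then have "finite Bad" unfolding Bad_def
    by (rule finite_UN_I) (clarsimp simp: J_def, rule finite_concur_zero; rule inj; auto)
  then have fin: "finite (Bad \<union> t ` {..<N})" by simp
  \<comment> \<open>The inserted 0 keeps the set nonempty, as \<open>Max\<close> needs.\<close>
  define y where "y = Max (insert 0 (Bad \<union> t ` {..<N})) + 1"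
  have y: "x < y" if "x \<in> Bad \<union> t ` {..<N}" for x
  proof -
    have "x \<le> Max (insert 0 (Bad \<union> t ` {..<N}))" using that fin by (intro Max_ge) auto
    then show ?thesis by (simp add: y_def)
  qed
  have nb: "concur (t a) (t b) (t c) (t d) (t e) y \<noteq> 0"
    if "distinct [a, b, c, d, e]" "{a, b, c, d, e} \<subseteq> {..<N}" for a b c d e
  proof -
    have "y \<notin> Bad" using y by blast
    moreover have "(a, b, c, d, e) \<in> J" using that by (simp add: J_def)
    ultimately show ?thesis unfolding Bad_def by fastforce
  qed
  define t' where "t' = t(N := y)"
  have "t' i < t' j" if "i < j" "j < Suc N" for i j
    using that t y by (auto simp: t'_def less_Suc_eq)
  moreover have "concur (t' a) (t' b) (t' c) (t' d) (t' e) (t' f) \<noteq> 0"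
    if dist: "distinct [a, b, c, d, e, f]" and sub: "{a, b, c, d, e, f} \<subseteq> {..<Suc N}" for a b c d e f
  proof -
    have lt: "i < N" if "i \<in> {a, b, c, d, e, f}" "i \<noteq> N" for i
      using sub that by (metis lessThan_iff less_Suc_eq subsetD)
    consider "N \<notin> {a, b, c, d, e, f}" | "f = N" | "e = N" | "d = N" | "c = N" | "b = N" | "a = N" by auto
    then show ?thesis
    proof cases
      case 1
      then have "{a, b, c, d, e, f} \<subseteq> {..<N}" using lt by blast
      then show ?thesis using g[OF dist] 1 by (simp add: t'_def)
    next
      case 2
      then show ?thesis using nb[of a b c d e] dist lt by (simp add: t'_def)
    next
      case 3
      then show ?thesis using nb[of a b c d f] dist lt concur_perm(5)[of "t a" "t b" "t c" "t d" y "t f"]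
        by (auto simp: t'_def)
    next
      case 4
      then show ?thesis using nb[of a b e f c] dist lt concur_perm(1)[of "t a" "t b" "t c" y "t e" "t f"]
        by (auto simp: t'_def)
    next
      case 5
      then show ?thesis using nb[of a b e f d] dist lt concur_perm(1)[of "t a" "t b" y "t d" "t e" "t f"]
          concur_perm(5)[of "t a" "t b" "t e" "t f" y "t d"]
        by (auto simp: t'_def)
    next
      case 6
      then show ?thesis using nb[of c d e f a] dist lt concur_perm(2)[of "t a" y "t c" "t d" "t e" "t f"]
          concur_perm(1)[of "t c" "t d" "t a" y "t e" "t f"]
        by (auto simp: t'_def)
    next
      case 7
      then show ?thesis using nb[of c d e f b] dist lt concur_perm(2)[of y "t b" "t c" "t d" "t e" "t f"]
          concur_perm(1)[of "t c" "t d" y "t b" "t e" "t f"] concur_perm(5)[of "t c" "t d" "t e" "t f" y "t b"]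
        by (auto simp: t'_def)
    qed
  qed
  ultimately show ?case by blast
qed

section \<open>Lifted chords as arcs\<close>

definition chord_path :: "real \<Rightarrow> real \<Rightarrow> real \<Rightarrow> real \<Rightarrow> real^3" where
  "chord_path s u v = lift s \<circ> linepath (circ u) (circ v)"

lemma lift_circ_3 [simp]: "lift s (circ u) $ 3 = 0"
  by (simp add: lift_3)

lemma lift_inj: "lift s z = lift s' z' \<Longrightarrow> z = z'"
  by (metis shadow_lift)

lemma lift_circ_indep: "lift s (circ u) = lift 1 (circ u)"
  by (simp add: lift_def)

lemma pathstart_chord_path [simp]: "pathstart (chord_path s u v) = lift s (circ u)"
  and pathfinish_chord_path [simp]: "pathfinish (chord_path s u v) = lift s (circ v)"
  by (simp_all add: chord_path_def pathstart_def pathfinish_def linepath_def)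

lemma arc_chord_path:
  assumes "u \<noteq> v" shows "arc (chord_path s u v)"
proof -
  have "arc (linepath (circ u) (circ v))" using assms circ_inj[of u v] by (intro arc_linepath) auto
  then show ?thesis unfolding arc_def path_def chord_path_def
    by (auto intro!: continuous_on_lift simp: o_def inj_on_def dest: lift_inj)
qed

lemma path_image_chord_path:
  assumes "s = 1 \<or> s = -1" "u \<noteq> v"
  shows "path_image (chord_path s u v) = insert (lift s (circ u)) (insert (lift s (circ v)) (chord s u v))"
proof -
  have "path_image (chord_path s u v) = (\<lambda>l. lift s ((1 - l) *\<^sub>R circ u + l *\<^sub>R circ v)) ` {0..1}"
    by (simp add: path_image_def chord_path_def linepath_def o_def)
  also have "{0..1::real} = insert 0 (insert 1 {0<..<1})" by auto
  finally show ?thesis using chord_affine[OF assms] by auto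
qed

lemma lift_circ_in_S2: "lift s (circ u) \<in> S2"
  unfolding mem_S2 by simp

section \<open>Drawings made of lifted chords\<close>

definition interleaved :: "nat \<times> nat \<Rightarrow> nat \<times> nat \<Rightarrow> bool" where
  "interleaved c d \<longleftrightarrow> fst c < fst d \<and> fst d < snd c \<and> snd c < snd d"

text \<open>As \<open>interleaved\<close> is asymmetric, each crossing is listed once. The sign is
  recorded because two edges might meet once on each hemisphere.\<close>

definition crossing_pairs ::
  "nat \<Rightarrow> (real \<Rightarrow> nat \<times> nat \<Rightarrow> nat \<times> nat \<Rightarrow> bool) \<Rightarrow> (real \<times> (nat \<times> nat) \<times> (nat \<times> nat)) set" where
  "crossing_pairs n K = {(s, a, b). a \<in> Kedges n \<and> b \<in> Kedges n \<and>
     (\<exists>c d. K s a c \<and> K s b d \<and> interleaved c d)}"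

text \<open>
  \<open>K s a (i, j)\<close> says that on the hemisphere of sign \<open>s\<close> the edge \<open>a\<close> runs along the chord between
  the equatorial points with parameters \<open>t i\<close> and \<open>t j\<close>; an edge has at most one such chord per hemisphere.
\<close>

locale lifted_drawing =
  fixes n N :: nat and D :: diagram and t :: "nat \<Rightarrow> real"
    and K :: "real \<Rightarrow> nat \<times> nat \<Rightarrow> nat \<times> nat \<Rightarrow> bool"
  assumes t_less: "\<And>i j. i < j \<Longrightarrow> j < N \<Longrightarrow> t i < t j"
    and generic: "\<And>a b c d e f. distinct [a, b, c, d, e, f] \<Longrightarrow> {a, b, c, d, e, f} \<subseteq> {..<N} \<Longrightarrow>
        concur (t a) (t b) (t c) (t d) (t e) (t f) \<noteq> 0"
    and K_dom: "\<And>s a c. K s a c \<Longrightarrow> (s = 1 \<or> s = -1) \<and> fst c < snd c \<and> snd c < N"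
    and K_fun: "\<And>s a c c'. K s a c \<Longrightarrow> K s a c' \<Longrightarrow> c = c'"
    and K_inj: "\<And>s a b c. K s a c \<Longrightarrow> K s b c \<Longrightarrow> a = b"
    and vertices_inj: "inj_on (fst D) {..<n}"
    and vertex_equator: "\<And>i. i < n \<Longrightarrow> fst D i \<in> S2 \<and> fst D i $ 3 = 0"
    and edge_arcs: "\<And>a. a \<in> Kedges n \<Longrightarrow> arc (edge_arc D a) \<and> path_image (edge_arc D a) \<subseteq> S2 \<and>
        pathstart (edge_arc D a) = fst D (fst a) \<and> pathfinish (edge_arc D a) = fst D (snd a)"
    and vertex_notin: "\<And>a k. a \<in> Kedges n \<Longrightarrow> k < n \<Longrightarrow> fst D k \<notin> arc_int (edge_arc D a)"
    and off_equator: "\<And>a s. a \<in> Kedges n \<Longrightarrow> s = 1 \<or> s = -1 \<Longrightarrow>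
        path_image (edge_arc D a) \<inter> {p. s * p $ 3 > 0} = (\<Union>c\<in>{c. K s a c}. chord s (t (fst c)) (t (snd c)))"
    and on_equator: "\<And>a b p. a \<in> Kedges n \<Longrightarrow> b \<in> Kedges n \<Longrightarrow> a \<noteq> b \<Longrightarrow>
        p \<in> arc_int (edge_arc D a) \<Longrightarrow> p \<in> arc_int (edge_arc D b) \<Longrightarrow> p $ 3 \<noteq> 0"
begin

abbreviation index_chord :: "real \<Rightarrow> nat \<times> nat \<Rightarrow> (real^3) set" where
  "index_chord s c \<equiv> chord s (t (fst c)) (t (snd c))"

lemma crossing_pairsI:
  "a \<in> Kedges n \<Longrightarrow> b \<in> Kedges n \<Longrightarrow> K s a c \<Longrightarrow> K s b d \<Longrightarrow> interleaved c d \<Longrightarrow> (s, a, b) \<in> crossing_pairs n K"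
  unfolding crossing_pairs_def by blast

lemma crossing_pairsE:
  assumes "(s, a, b) \<in> crossing_pairs n K"
  obtains c d where "a \<in> Kedges n" "b \<in> Kedges n" "K s a c" "K s b d" "interleaved c d"
  using assms unfolding crossing_pairs_def by blast

lemma crossing_pairs_sign: "(s, a, b) \<in> crossing_pairs n K \<Longrightarrow> s = 1 \<or> s = -1"
  using K_dom by (blast elim: crossing_pairsE)

lemma t_less_iff: "i < N \<Longrightarrow> j < N \<Longrightarrow> t i < t j \<longleftrightarrow> i < j"
  using t_less[of i j] t_less[of j i] by (cases i j rule: linorder_cases) auto

lemma t_eq_iff: "i < N \<Longrightarrow> j < N \<Longrightarrow> t i = t j \<longleftrightarrow> i = j"
  using t_less[of i j] t_less[of j i] by (cases i j rule: linorder_cases) auto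

lemma Kedges_lt: "a \<in> Kedges n \<Longrightarrow> fst a < n \<and> snd a < n"
  by (auto simp: Kedges_def)

lemma index_chord_subset:
  assumes "a \<in> Kedges n" "K s a c" "p \<in> index_chord s c"
  shows "p \<in> arc_int (edge_arc D a)"
proof -
  have s: "s = 1 \<or> s = -1" using K_dom assms by blast
  have "p \<in> path_image (edge_arc D a) \<inter> {p. s * p $ 3 > 0}"
    using assms unfolding off_equator[OF assms(1) s] by blast
  moreover have "fst D (fst a) $ 3 = 0" "fst D (snd a) $ 3 = 0"
    using vertex_equator Kedges_lt[OF assms(1)] by blast+
  ultimately show ?thesis using edge_arcs[OF assms(1)] by (auto simp: arc_int_def)
qed

lemma arc_int_chord:
  assumes "a \<in> Kedges n" "p \<in> arc_int (edge_arc D a)" "s = 1 \<or> s = -1" "s * p $ 3 > 0"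
  obtains c where "K s a c" "p \<in> index_chord s c"
proof -
  have "p \<in> path_image (edge_arc D a) \<inter> {p. s * p $ 3 > 0}"
    using assms by (simp add: arc_int_def)
  then show thesis using that unfolding off_equator[OF assms(1,3)] by blast
qed

lemma index_chords_meet_imp:
  assumes "a \<noteq> b" "K s a c" "K s b d" "p \<in> index_chord s c" "p \<in> index_chord s d"
  shows "interleaved c d \<or> interleaved d c"
proof -
  have s: "s = 1 \<or> s = -1" and c: "fst c < snd c" "snd c < N" and d: "fst d < snd d" "snd d < N"
    using K_dom assms by blast+
  have "c \<noteq> d" using K_inj assms by blast
  then have "(t (fst c), t (snd c)) \<noteq> (t (fst d), t (snd d))"
    using c d by (auto simp: t_eq_iff prod_eq_iff)
  from chords_meet_imp[OF s _ _ this assms(4,5)] show ?thesis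
    using c d by (auto simp: t_less_iff interleaved_def)
qed

lemma common_point:
  assumes "a \<in> Kedges n" "b \<in> Kedges n" "a \<noteq> b"
    "p \<in> arc_int (edge_arc D a)" "p \<in> arc_int (edge_arc D b)"
  obtains s c d where "s = 1 \<or> s = -1" "s * p $ 3 > 0" "K s a c" "K s b d"
    "p \<in> index_chord s c" "p \<in> index_chord s d"
proof -
  have "p $ 3 \<noteq> 0" using on_equator assms by blast
  then obtain s where s: "s = 1 \<or> s = -1" "s * p $ 3 > 0"
    by (metis linorder_neqE_linordered_idom mult_1 mult_minus1 neg_0_less_iff_less)
  then show thesis using that arc_int_chord[OF assms(1,4) s] arc_int_chord[OF assms(2,5) s] by metis
qed

text \<open>Three chords that interleave pairwise have six distinct ends, so generic parameters
  exclude a common point.\<close>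

lemma no_triple_point:
  assumes "a \<in> Kedges n" "b \<in> Kedges n" "e \<in> Kedges n" "a \<noteq> b" "e \<noteq> a" "e \<noteq> b"
    "p \<in> arc_int (edge_arc D a)" "p \<in> arc_int (edge_arc D b)"
  shows "p \<notin> arc_int (edge_arc D e)"
proof
  assume pe: "p \<in> arc_int (edge_arc D e)"
  obtain s c d where s: "s = 1 \<or> s = -1" "s * p $ 3 > 0" and K: "K s a c" "K s b d"
    and p: "p \<in> index_chord s c" "p \<in> index_chord s d"
    using common_point assms by metis
  obtain f where f: "K s e f" "p \<in> index_chord s f" using arc_int_chord[OF assms(3) pe s] by blast
  have i: "interleaved c d \<or> interleaved d c" "interleaved f c \<or> interleaved c f" "interleaved f d \<or> interleaved d f"
    using index_chords_meet_imp K p f assms by blast+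
  then have "distinct [fst c, snd c, fst d, snd d, fst f, snd f]" by (auto simp: interleaved_def)
  moreover have "{fst c, snd c, fst d, snd d, fst f, snd f} \<subseteq> {..<N}"
    using K_dom[OF K(1)] K_dom[OF K(2)] K_dom[OF f(1)] by auto
  ultimately have "concur (t (fst c)) (t (snd c)) (t (fst d)) (t (snd d)) (t (fst f)) (t (snd f)) \<noteq> 0"
    using generic by blast
  then show False using concur_zero p f(2) unfolding chord_def by blast
qed

lemma transverse_crossing:
  assumes "a \<in> Kedges n" "b \<in> Kedges n" "a \<noteq> b"
    "p \<in> arc_int (edge_arc D a)" "p \<in> arc_int (edge_arc D b)"
  shows "transverse_at (path_image (edge_arc D a)) (path_image (edge_arc D b)) p"
proof -
  obtain s c d where s: "s = 1 \<or> s = -1" "s * p $ 3 > 0" and K: "K s a c" "K s b d"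
    and p: "p \<in> index_chord s c" "p \<in> index_chord s d"
    using common_point assms by metis
  have lt: "fst c < snd c" "snd c < N" "fst d < snd d" "snd d < N" using K_dom K by blast+
  let ?d = "\<lambda>c d. (1 - t (fst c) * t (snd c)) * (t (fst d) + t (snd d)) -
        (1 - t (fst d) * t (snd d)) * (t (fst c) + t (snd c))"
  have det: "?d c d \<noteq> 0" if "interleaved c d" "fst c < snd c" "snd c < N" "fst d < snd d" "snd d < N" for c d
    using that by (intro chords_not_parallel) (auto simp: interleaved_def t_less_iff)
  \<comment> \<open>The determinant only changes sign when the chords are exchanged, so either order
    of interleaving will do.\<close>
  have "?d c d = - ?d d c" by simp
  then have d0: "?d c d \<noteq> 0" using index_chords_meet_imp[OF assms(3) K p] det[of c d] det[of d c] lt by fastforce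
  have "{f. K s a f} = {c}" "{f. K s b f} = {d}" using K K_fun by blast+
  then show ?thesis
    using transverse_chords[OF s(1) d0 p] off_equator[OF assms(1) s(1)] off_equator[OF assms(2) s(1)]
    by simp
qed

definition meeting_point :: "real \<times> (nat \<times> nat) \<times> (nat \<times> nat) \<Rightarrow> real^3" where
  "meeting_point = (\<lambda>(s, a, b). THE p. p \<in> arc_int (edge_arc D a) \<and> p \<in> arc_int (edge_arc D b) \<and> s * p $ 3 > 0)"

lemma meeting_point_unique:
  assumes "(s, a, b) \<in> crossing_pairs n K"
  shows "\<exists>!p. p \<in> arc_int (edge_arc D a) \<and> p \<in> arc_int (edge_arc D b) \<and> s * p $ 3 > 0"
proof -
  obtain c d where ab: "a \<in> Kedges n" "b \<in> Kedges n" and K: "K s a c" "K s b d" and i: "interleaved c d"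
    using assms by (auto simp: crossing_pairs_def)
  have s: "s = 1 \<or> s = -1" and lt: "fst c < snd c" "snd c < N" "fst d < snd d" "snd d < N"
    using K_dom K by blast+
  have "\<exists>!p. p \<in> index_chord s c \<and> p \<in> index_chord s d"
    using i lt by (intro chords_meet[OF s]) (auto simp: interleaved_def t_less_iff)
  moreover have "p \<in> index_chord s c \<and> p \<in> index_chord s d \<longleftrightarrow>
      p \<in> arc_int (edge_arc D a) \<and> p \<in> arc_int (edge_arc D b) \<and> s * p $ 3 > 0" for p
    using index_chord_subset ab K arc_int_chord[OF ab(1) _ s, of p] arc_int_chord[OF ab(2) _ s, of p] K_fun
    by (metis (mono_tags, lifting) chord_def mem_Collect_eq)
  ultimately show ?thesis by simp
qed

lemma meeting_point:
  assumes "(s, a, b) \<in> crossing_pairs n K"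
  shows "meeting_point (s, a, b) \<in> arc_int (edge_arc D a)" "meeting_point (s, a, b) \<in> arc_int (edge_arc D b)"
    "s * meeting_point (s, a, b) $ 3 > 0"
  using theI'[OF meeting_point_unique[OF assms]] by (auto simp: meeting_point_def)

lemma crossing_pairs_asym:
  assumes "(s, a, b) \<in> crossing_pairs n K" shows "(s, b, a) \<notin> crossing_pairs n K"
proof
  assume "(s, b, a) \<in> crossing_pairs n K"
  then obtain c d where "K s b d" "K s a c" "interleaved d c" by (blast elim: crossing_pairsE)
  moreover obtain c' d' where "K s a c'" "K s b d'" "interleaved c' d'" using assms by (blast elim: crossing_pairsE)
  ultimately have "interleaved d c" "interleaved c d" using K_fun by metis+
  then show False by (auto simp: interleaved_def)
qed

lemma crossing_pairs_neq: "(s, a, b) \<in> crossing_pairs n K \<Longrightarrow> a \<noteq> b"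
  using crossing_pairs_asym by blast

lemma edges_meet_iff:
  assumes "a \<in> Kedges n" "b \<in> Kedges n" "a \<noteq> b"
  shows "p \<in> arc_int (edge_arc D a) \<and> p \<in> arc_int (edge_arc D b) \<longleftrightarrow>
    (\<exists>s. (s, a, b) \<in> crossing_pairs n K \<and> p = meeting_point (s, a, b) \<or>
         (s, b, a) \<in> crossing_pairs n K \<and> p = meeting_point (s, b, a))" (is "?L \<longleftrightarrow> ?R")
proof
  assume p: ?L
  then obtain s c d where s: "s = 1 \<or> s = -1" "s * p $ 3 > 0" and K: "K s a c" "K s b d"
    and pc: "p \<in> index_chord s c" "p \<in> index_chord s d"
    using common_point assms by metis
  from index_chords_meet_imp[OF assms(3) K pc]
  have "(s, a, b) \<in> crossing_pairs n K \<or> (s, b, a) \<in> crossing_pairs n K"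
    using K assms crossing_pairsI by blast
  then show ?R using p s meeting_point_unique meeting_point by metis
next
  assume ?R
  then show ?L using meeting_point by blast
qed

text \<open>This makes the crossing number a count of index pairs. A crossing determines its
  unordered pair of edges as there are no triple points, its sign by the third coordinate, and the
  order of the pair by asymmetry.\<close>

lemma bij_meeting_point: "bij_betw meeting_point (crossing_pairs n K) (crossings n D)"
proof (rule bij_betw_imageI)
  show "inj_on meeting_point (crossing_pairs n K)"
  proof (rule inj_onI)
    fix x y
    assume x: "x \<in> crossing_pairs n K" and y: "y \<in> crossing_pairs n K" and xy: "meeting_point x = meeting_point y"
    obtain s a b s' a' b' where xy_eq: "x = (s, a, b)" "y = (s', a', b')" by (cases x, cases y) auto
    have 1: "(s, a, b) \<in> crossing_pairs n K" and 2: "(s', a', b') \<in> crossing_pairs n K"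
      and eq: "meeting_point (s, a, b) = meeting_point (s', a', b')"
      using x y xy unfolding xy_eq by simp_all
    let ?p = "meeting_point (s, a, b)"
    have E: "a \<in> Kedges n" "b \<in> Kedges n" "a' \<in> Kedges n" "b' \<in> Kedges n"
      and S: "s = 1 \<or> s = -1" "s' = 1 \<or> s' = -1"
      using 1 2 crossing_pairs_sign by (blast elim: crossing_pairsE)+
    have "s = s'" using S meeting_point(3)[OF 1] meeting_point(3)[OF 2] eq by auto
    moreover have "a' \<in> {a, b}" "b' \<in> {a, b}"
      using no_triple_point[OF E(1,2) _ crossing_pairs_neq[OF 1], of _ ?p] E
        meeting_point(1,2)[OF 1] meeting_point(1,2)[OF 2] eq by (metis insertCI)+
    ultimately show "x = y" unfolding xy_eq
      using crossing_pairs_neq[OF 2] crossing_pairs_asym[OF 1] 2 by blast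
  qed
  show "meeting_point ` (crossing_pairs n K) = crossings n D"
  proof (intro equalityI subsetI)
    fix p assume "p \<in> meeting_point ` (crossing_pairs n K)"
    then obtain s a b where c: "(s, a, b) \<in> crossing_pairs n K" "p = meeting_point (s, a, b)" by auto
    moreover have "a \<in> Kedges n" "b \<in> Kedges n" using c by (auto simp: crossing_pairs_def)
    ultimately show "p \<in> crossings n D"
      using meeting_point(1,2)[OF c(1)] crossing_pairs_neq[OF c(1)] by (auto simp: crossings_def)
  next
    fix p assume "p \<in> crossings n D"
    then obtain a b where "a \<in> Kedges n" "b \<in> Kedges n" "a \<noteq> b"
      "p \<in> arc_int (edge_arc D a) \<and> p \<in> arc_int (edge_arc D b)"
      by (auto simp: crossings_def)
    then show "p \<in> meeting_point ` (crossing_pairs n K)"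
      using edges_meet_iff[of a b p] by blast
  qed
qed

lemma finite_crossing_pairs: "finite (crossing_pairs n K)"
proof -
  have "finite (Kedges n)"
    by (rule finite_subset[of _ "{..<n} \<times> {..<n}"]) (auto simp: Kedges_def)
  moreover have "crossing_pairs n K \<subseteq> {1, -1} \<times> Kedges n \<times> Kedges n"
  proof
    fix x assume x: "x \<in> crossing_pairs n K"
    obtain s a b where "x = (s, a, b)" by (cases x) auto
    then show "x \<in> {1, -1} \<times> Kedges n \<times> Kedges n"
      using x crossing_pairs_sign[of s a b] by (auto elim: crossing_pairsE)
  qed
  ultimately show ?thesis by (meson finite.intros finite_SigmaI finite_subset)
qed

lemma is_diagram: "is_diagram n D"
  unfolding is_diagram_def
  using vertices_inj vertex_equator edge_arcs vertex_notin no_triple_point transverse_crossing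
    bij_betw_finite[OF bij_meeting_point] finite_crossing_pairs
  by (metis (no_types, lifting) Int_iff)

lemma crossing_number: "crossing_number n D = card (crossing_pairs n K)"
  unfolding crossing_number_def using bij_betw_same_card[OF bij_meeting_point] by simp

lemma edge_has_crossing_iff:
  assumes "a \<in> Kedges n"
  shows "edge_has_crossing n D a \<longleftrightarrow> (\<exists>s b. (s, a, b) \<in> crossing_pairs n K \<or> (s, b, a) \<in> crossing_pairs n K)"
proof -
  have *: "a' \<in> Kedges n \<and> b' \<in> Kedges n \<and> a' \<noteq> b'" if "(s, a', b') \<in> crossing_pairs n K" for s a' b'
    using that crossing_pairs_neq[OF that] by (auto simp: crossing_pairs_def)
  have "edge_has_crossing n D a \<longleftrightarrow> (\<exists>b\<in>Kedges n. b \<noteq> a \<and> (\<exists>s. (s, a, b) \<in> crossing_pairs n K \<or> (s, b, a) \<in> crossing_pairs n K))"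
    unfolding edge_has_crossing_def using edges_meet_iff[OF assms] by fastforce
  then show ?thesis using * by metis
qed

end

section \<open>The drawing\<close>

text \<open>In a regular polygon the chords with a given sum of ends modulo \<open>2 * m + 1\<close>
  are parallel; each page takes an interval of these classes, \<open>m\<close> below and
  \<open>m + 1\<close> above.\<close>

definition page :: "nat \<Rightarrow> nat \<times> nat \<Rightarrow> real" where
  "page m a = (if (fst a + snd a) mod (2 * m + 1) < m then - 1 else 1)"

text \<open>
  Vertex \<open>i\<close> has parameter \<open>t (2 i)\<close>; the odd index \<open>2 m + 3\<close> is the point between the vertices
  \<open>m + 1\<close> and \<open>m + 2\<close> where the rerouted edge \<open>(0, m)\<close> passes from one hemisphere to the other.
\<close>

definition piece :: "nat \<Rightarrow> real \<Rightarrow> nat \<times> nat \<Rightarrow> nat \<times> nat \<Rightarrow> bool" where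
  "piece m s a c \<longleftrightarrow> a \<in> Kedges (2 * m + 1) \<and>
     (if a = (0, m) then s = - 1 \<and> c = (2 * m, 2 * m + 3) \<or> s = 1 \<and> c = (0, 2 * m + 3)
      else s = page m a \<and> c = (2 * fst a, 2 * snd a))"

definition drawing :: "nat \<Rightarrow> (nat \<Rightarrow> real) \<Rightarrow> diagram" where
  "drawing m t = (\<lambda>i. lift 1 (circ (t (2 * i))),
     \<lambda>i j. if (i, j) = (0, m)
       then chord_path 1 (t 0) (t (2 * m + 3)) +++ chord_path (- 1) (t (2 * m + 3)) (t (2 * m))
       else chord_path (page m (i, j)) (t (2 * i)) (t (2 * j)))"

lemma chord_commute: "chord s u v = chord s v u"
  by (simp add: chord_def lin_def mult.commute add.commute)

lemma page_sign: "page m a = 1 \<or> page m a = - 1"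
  by (simp add: page_def)

lemma lift_circ_eq_iff [simp]: "lift s (circ u) = lift s' (circ v) \<longleftrightarrow> u = v"
  using lift_inj circ_inj lift_circ_indep by metis

lemma lift_circ_notin_chord [simp]: "lift s (circ u) \<notin> chord s' v w"
  by (simp add: chord_def)

text \<open>The vertices use the even indices up to \<open>4 * m\<close>. Only the interior of the
  rerouted edge meets the equator, in the single point of index \<open>2 * m + 3\<close>, which is
  odd and so is not a vertex.\<close>

lemma lifted_drawing_drawing:
  fixes t :: "nat \<Rightarrow> real"
  assumes m: "3 \<le> m"
    and t: "\<And>i j. i < j \<Longrightarrow> j < 4 * m + 1 \<Longrightarrow> t i < t j"
    and g: "\<And>a b c d e f. distinct [a, b, c, d, e, f] \<Longrightarrow> {a, b, c, d, e, f} \<subseteq> {..<4 * m + 1} \<Longrightarrow>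
        concur (t a) (t b) (t c) (t d) (t e) (t f) \<noteq> 0"
  shows "lifted_drawing (2 * m + 1) (4 * m + 1) (drawing m t) t (piece m)"
proof -
  let ?D = "drawing m t" and ?n = "2 * m + 1"
  have t_eq: "t i = t j \<longleftrightarrow> i = j" if "i < 4 * m + 1" "j < 4 * m + 1" for i j
    using t[of i j] t[of j i] that by (cases i j rule: linorder_cases) auto
  have V: "fst ?D i = lift 1 (circ (t (2 * i)))" for i by (simp add: drawing_def)
  have V_eq: "lift 1 (circ (t (2 * i))) = lift s (circ (t (2 * j))) \<longleftrightarrow> i = j" if "i < ?n" "j < ?n" for i j s
    using that t_eq[of "2 * i" "2 * j"] by auto
  have odd: "t (2 * i) \<noteq> t (2 * m + 3)" if "i < ?n" for i
    using that t_eq[of "2 * i" "2 * m + 3"] m by (simp, presburger)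
  have short: "edge_arc ?D a = chord_path (page m a) (t (2 * fst a)) (t (2 * snd a))" if "a \<noteq> (0, m)" for a
    using that by (auto simp: edge_arc_def drawing_def prod_eq_iff)
  have long: "edge_arc ?D (0, m) = chord_path 1 (t 0) (t (2 * m + 3)) +++ chord_path (- 1) (t (2 * m + 3)) (t (2 * m))"
    by (simp add: edge_arc_def drawing_def)
  have e0: "(0, m) \<in> Kedges ?n" using m by (simp add: Kedges_def)
  have join: "pathfinish (chord_path 1 (t 0) (t (2 * m + 3))) = pathstart (chord_path (- 1) (t (2 * m + 3)) (t (2 * m)))"
    by simp
  have ne: "t 0 \<noteq> t (2 * m + 3)" "t (2 * m + 3) \<noteq> t (2 * m)" "t 0 \<noteq> t (2 * m)"
    using odd[of 0] odd[of m] t_eq[of 0 "2 * m"] m by auto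
  have edge_ne: "t (2 * fst a) \<noteq> t (2 * snd a)" "fst a < ?n" "snd a < ?n" if "a \<in> Kedges ?n" for a
    using that t_eq[of "2 * fst a" "2 * snd a"] by (auto simp: Kedges_def)
  have image_short: "path_image (edge_arc ?D a) =
      insert (fst ?D (fst a)) (insert (fst ?D (snd a)) (chord (page m a) (t (2 * fst a)) (t (2 * snd a))))"
    if "a \<in> Kedges ?n" "a \<noteq> (0, m)" for a
    unfolding short[OF that(2)] path_image_chord_path[OF page_sign edge_ne(1)[OF that(1)]]
    by (simp add: V lift_circ_indep[of "page m a"])
  have image_long: "path_image (edge_arc ?D (0, m)) =
      insert (fst ?D 0) (insert (fst ?D m) (insert (lift 1 (circ (t (2 * m + 3))))
        (chord 1 (t 0) (t (2 * m + 3)) \<union> chord (- 1) (t (2 * m + 3)) (t (2 * m)))))"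
    unfolding long path_image_join[OF join] using ne
    by (auto simp: path_image_chord_path V lift_circ_indep[of "- 1"])
  have int_short: "arc_int (edge_arc ?D a) = chord (page m a) (t (2 * fst a)) (t (2 * snd a))"
    if "a \<in> Kedges ?n" "a \<noteq> (0, m)" for a
    unfolding arc_int_def image_short[OF that] unfolding short[OF that(2)]
    by (auto simp: V lift_circ_indep[of "page m a"])
  have int_long: "arc_int (edge_arc ?D (0, m)) = insert (lift 1 (circ (t (2 * m + 3))))
        (chord 1 (t 0) (t (2 * m + 3)) \<union> chord (- 1) (t (2 * m + 3)) (t (2 * m)))"
    unfolding arc_int_def image_long unfolding long using ne
    by (auto simp: V lift_circ_indep[of "- 1"])
  have chord3: "p $ 3 \<noteq> 0" if "p \<in> chord s u v" for p s u v using that by (auto simp: chord_def)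
  have equator: "a = (0, m) \<and> p = lift 1 (circ (t (2 * m + 3)))"
    if "a \<in> Kedges ?n" "p \<in> arc_int (edge_arc ?D a)" "p $ 3 = 0" for a p
    using that int_short[of a] int_long chord3 by (cases "a = (0, m)") blast+
  have piece_chords: "(\<Union>c\<in>{c. piece m s a c}. chord s (t (fst c)) (t (snd c))) =
     (if a = (0, m) then (if s = 1 then chord 1 (t 0) (t (2 * m + 3))
         else if s = - 1 then chord (- 1) (t (2 * m)) (t (2 * m + 3)) else {})
      else if s = page m a then chord s (t (2 * fst a)) (t (2 * snd a)) else {})"
    if "a \<in> Kedges ?n" for a s
  proof -
    have "{c. piece m s a c} = (if a = (0, m) then (if s = 1 then {(0, 2 * m + 3)}
         else if s = - 1 then {(2 * m, 2 * m + 3)} else {})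
      else if s = page m a then {(2 * fst a, 2 * snd a)} else {})"
      using that by (auto simp: piece_def)
    then show ?thesis by simp
  qed
  have chord_other: "chord s u v \<inter> {p. s' * p $ 3 > 0} = (if s = s' then chord s u v else {})"
    if "s = 1 \<or> s = -1" "s' = 1 \<or> s' = -1" for s s' u v
    using that by (auto simp: chord_def)
  show ?thesis
  proof
    show "t i < t j" if "i < j" "j < 4 * m + 1" for i j using t that .
    show "concur (t a) (t b) (t c) (t d) (t e) (t f) \<noteq> 0"
      if "distinct [a, b, c, d, e, f]" "{a, b, c, d, e, f} \<subseteq> {..<4 * m + 1}" for a b c d e f
      using g that .
    show "(s = 1 \<or> s = -1) \<and> fst c < snd c \<and> snd c < 4 * m + 1" if "piece m s a c" for s a c
      using that m page_sign[of m a] by (auto simp: piece_def Kedges_def split: if_splits)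
    show "c = c'" if "piece m s a c" "piece m s a c'" for s a c c'
      using that by (auto simp: piece_def split: if_splits)
    show "a = b" if "piece m s a c" "piece m s b c" for s a b c
      using that by (auto simp: piece_def prod_eq_iff split: if_splits) presburger+
    show "inj_on (fst ?D) {..<?n}"
      by (rule inj_onI) (use V_eq in \<open>auto simp: V\<close>)
    show "fst ?D i \<in> S2 \<and> fst ?D i $ 3 = 0" if "i < ?n" for i
      unfolding V using lift_circ_in_S2 by simp
    show "fst ?D k \<notin> arc_int (edge_arc ?D a)" if "a \<in> Kedges ?n" "k < ?n" for a k
      using equator[OF that(1), of "fst ?D k"] odd[OF that(2)] by (auto simp: V)
    show "path_image (edge_arc ?D a) \<inter> {p. s * p $ 3 > 0} = (\<Union>c\<in>{c. piece m s a c}. chord s (t (fst c)) (t (snd c)))"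
      if a: "a \<in> Kedges ?n" and s: "s = 1 \<or> s = -1" for a s
    proof (cases "a = (0, m)")
      case True
      then show ?thesis unfolding piece_chords[OF a]
        using s by (auto simp: image_long V Int_Un_distrib2 chord_other chord_commute)
    next
      case False
      then show ?thesis unfolding piece_chords[OF a] image_short[OF a False]
        using s chord_other[OF page_sign s] by (auto simp: V)
    qed
    show "p $ 3 \<noteq> 0" if "a \<in> Kedges ?n" "b \<in> Kedges ?n" "a \<noteq> b"
      "p \<in> arc_int (edge_arc ?D a)" "p \<in> arc_int (edge_arc ?D b)" for a b p
      using equator that by blast
    show "arc (edge_arc ?D a) \<and> path_image (edge_arc ?D a) \<subseteq> S2 \<and>
        pathstart (edge_arc ?D a) = fst ?D (fst a) \<and> pathfinish (edge_arc ?D a) = fst ?D (snd a)"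
      if a: "a \<in> Kedges ?n" for a
    proof (cases "a = (0, m)")
      case True
      have "arc (edge_arc ?D (0, m))" unfolding long
      proof (rule arc_join[OF _ _ join])
        \<comment> \<open>Apart from their ends, the two halves lie on opposite hemispheres.\<close>
        show "path_image (chord_path 1 (t 0) (t (2 * m + 3))) \<inter> path_image (chord_path (- 1) (t (2 * m + 3)) (t (2 * m)))
            \<subseteq> {pathstart (chord_path (- 1) (t (2 * m + 3)) (t (2 * m)))}"
          using ne by (auto simp: path_image_chord_path) (auto simp: chord_def)
      qed (use ne in \<open>simp_all add: arc_chord_path\<close>)
      moreover have "path_image (edge_arc ?D (0, m)) \<subseteq> S2"
        unfolding image_long V using lift_circ_in_S2 by (auto simp: chord_def)
      ultimately show ?thesis using True by (simp add: V long lift_circ_indep[of "- 1"])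
    next
      case False
      have "path_image (edge_arc ?D a) \<subseteq> S2"
        unfolding image_short[OF a False] V using lift_circ_in_S2 by (auto simp: chord_def)
      then show ?thesis using False edge_ne[OF a]
        by (simp add: short V arc_chord_path lift_circ_indep[of "page m a"])
    qed
  qed
qed

section \<open>Counting the crossings\<close>

definition same_page :: "nat \<Rightarrow> nat \<Rightarrow> nat \<Rightarrow> bool" where
  "same_page m x y \<longleftrightarrow> (x mod (2 * m + 1) < m \<longleftrightarrow> y mod (2 * m + 1) < m)"

text \<open>The crossings of the two-page drawing before \<open>(0, m)\<close> is rerouted.\<close>

definition quads :: "nat \<Rightarrow> ((nat \<times> nat) \<times> (nat \<times> nat)) set" where
  "quads m = {((x0, x2), (x1, x3)). x0 < x1 \<and> x1 < x2 \<and> x2 < x3 \<and> x3 < 2 * m + 1 \<and>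
     same_page m (x0 + x2) (x1 + x3)}"

definition page_rank :: "nat \<Rightarrow> nat \<Rightarrow> nat" where
  "page_rank m r = (if r < m then r else r - m)"

text \<open>
  The class of a chord is the sum of its ends modulo \<open>n = 2 m + 1\<close>; a page is an interval of classes, and
  crossing chords have distinct classes. In the code \<open>(k, i, b, j)\<close> of a crossing, the chord of larger class
  joins \<open>b\<close> to \<open>b + k + 1\<close>, with the \<open>k < m\<close> vertices of its short side in between, and the other
  chord joins \<open>b + k + 1 - i\<close> to \<open>b - (j - i)\<close>, all modulo \<open>n\<close>. Then \<open>j\<close> is the difference of the two
  classes, so the chords lie on the same page iff \<open>j\<close> is at most the rank of the larger class in its page.
\<close>

definition codes :: "nat \<Rightarrow> (nat \<times> nat \<times> nat \<times> nat) set" where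
  "codes m = (SIGMA k:{..<m}. SIGMA i:{1..k}. SIGMA b:{..<2 * m + 1}. {i<..page_rank m ((2 * b + k + 1) mod (2 * m + 1))})"

text \<open>The four ends in cyclic order are \<open>b - g\<close>, \<open>b\<close>,
  \<open>b + k + 1 - i\<close>, \<open>b + k + 1\<close>. The cases say which of them leave the
  range \<open>0..<n\<close> and are reduced: only the first, none, only the last, or the last
  two.\<close>

definition decode :: "nat \<Rightarrow> nat \<times> nat \<times> nat \<times> nat \<Rightarrow> (nat \<times> nat) \<times> (nat \<times> nat)" where
  "decode m = (\<lambda>(k, i, b, j). let n = 2 * m + 1; g = j - i in
     if b < g then ((b, b + k + 1), (b + k + 1 - i, b + n - g))
     else if b + k + 1 < n then ((b - g, b + k + 1 - i), (b, b + k + 1))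
     else if b + k + 1 - i < n then ((b + k + 1 - n, b), (b - g, b + k + 1 - i))
     else ((b + k + 1 - i - n, b - g), (b + k + 1 - n, b)))"

text \<open>The outer test finds the chord of larger class, the inner one its short side. As
  \<open>n\<close> is odd, the two sides never hold equally many vertices.\<close>

definition encode :: "nat \<Rightarrow> (nat \<times> nat) \<times> (nat \<times> nat) \<Rightarrow> nat \<times> nat \<times> nat \<times> nat" where
  "encode m = (\<lambda>((x0, x2), (x1, x3)). let n = 2 * m + 1 in
     if (x1 + x3) mod n < (x0 + x2) mod n then
       (if x2 - x0 \<le> m then (x2 - x0 - 1, x2 - x1, x0, (x2 - x1) + (x0 + n - x3))
        else (x0 + n - x2 - 1, x0 + n - x3, x2, (x0 + n - x3) + (x2 - x1)))
     else
       (if x3 - x1 \<le> m then (x3 - x1 - 1, x3 - x2, x1, (x3 - x2) + (x1 - x0))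
        else (x1 + n - x3 - 1, x1 - x0, x3, (x1 - x0) + (x3 - x2))))"

lemma encode_decode:
  assumes "p \<in> codes m"
  shows "decode m p \<in> quads m \<and> encode m (decode m p) = p"
proof -
  obtain k i b j where p: "p = (k, i, b, j)" by (cases p)
  define n where "n = 2 * m + 1"
  define t where "t = (2 * b + k + 1) mod n"
  have a: "k < m" "1 \<le> i" "i \<le> k" "b < n" "i < j" "j \<le> page_rank m t"
    using assms by (auto simp: p codes_def n_def t_def)
  have t: "t < n" by (simp add: t_def n_def)
  \<comment> \<open>Going down by at most the rank does not leave the interval of classes of the
    page.\<close>
  have jt: "j \<le> t" "t - j < m \<longleftrightarrow> t < m" using a t by (auto simp: page_rank_def n_def split: if_splits)
  have jm: "j \<le> m" using a t by (auto simp: page_rank_def n_def split: if_splits)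
  obtain q where q: "2 * b + k + 1 = t + q * n" unfolding t_def by (metis mod_div_mult_eq)
  have r1: "x mod n = t" if "x = 2 * b + k + 1 \<or> x + n = 2 * b + k + 1" for x
    using that unfolding t_def by (metis mod_add_self2)
  have r2: "x mod n = t - j" if "x + j = 2 * b + k + 1 \<or> x + j = 2 * b + k + 1 + n \<or> x + j + n = 2 * b + k + 1 \<or> x + j + 2 * n = 2 * b + k + 1" for x
  proof -
    have "x + j = t + q * n \<or> x + j = t + (q + 1) * n \<or> x + j + n = t + q * n \<or> x + j + 2 * n = t + q * n"
      using that q by auto
    \<comment> \<open>In the integers, as the shifted quotients may be negative.\<close>
    then have "int x = int (t - j) + int q * int n \<or> int x = int (t - j) + (int q + 1) * int n \<or>
       int x = int (t - j) + (int q - 1) * int n \<or> int x = int (t - j) + (int q - 2) * int n"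
      using jt(1) by (auto simp: algebra_simps of_nat_diff simp flip: of_nat_mult of_nat_add)
    then have "int x mod int n = int (t - j) mod int n" by (metis mod_mult_self1)
    then have "x mod n = (t - j) mod n" by (metis of_nat_eq_iff of_nat_mod)
    then show ?thesis using t by simp
  qed
  define g where "g = j - i"
  have g: "1 \<le> g" "j = i + g" using a by (auto simp: g_def)
  have dec: "decode m p = (if b < g then ((b, b + k + 1), (b + k + 1 - i, b + n - g))
     else if b + k + 1 < n then ((b - g, b + k + 1 - i), (b, b + k + 1))
     else if b + k + 1 - i < n then ((b + k + 1 - n, b), (b - g, b + k + 1 - i))
     else ((b + k + 1 - i - n, b - g), (b + k + 1 - n, b)))"
    by (simp add: decode_def p Let_def g_def n_def)
  consider (A) "b < g" | (B) "g \<le> b" "b + k + 1 < n" | (C) "g \<le> b" "n \<le> b + k + 1" "b + k + 1 - i < n"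
    | (D) "g \<le> b" "n \<le> b + k + 1" "n \<le> b + k + 1 - i" by linarith
  then show ?thesis
  proof cases
    case A
    define y0 y2 where "y0 = b + n - g" and "y2 = b + k + 1 - i"
    have y: "y0 + g = b + n" "y2 + i = b + k + 1" using A a g jm by (auto simp: y0_def y2_def n_def)
    have 1: "(b + (b + k + 1)) mod n = t" by (rule r1) simp
    have 2: "(y2 + y0) mod n = t - j" by (rule r2) (use y g in linarith)
    have "same_page m (b + (b + k + 1)) (y2 + y0)"
      unfolding same_page_def n_def[symmetric] 1 2 using jt by simp
    moreover have "b < y2" "y2 < b + k + 1" "b + k + 1 < y0" "y0 < n"
      using A a g jm y n_def by linarith+
    moreover have "decode m p = ((b, b + k + 1), (y2, y0))" unfolding dec using A by (simp add: y0_def y2_def)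
    moreover have "t - j < t" using jt a by linarith
    moreover have "encode m ((b, b + k + 1), (y2, y0)) = (k, i, b, j)"
    proof -
      have "b + k + 1 - b \<le> m" "b + k + 1 - b - 1 = k" "b + k + 1 - y2 = i" "i + (b + n - y0) = j"
        using a y g by linarith+
      then show ?thesis unfolding encode_def n_def[symmetric] Let_def prod.case 1 2
        using \<open>t - j < t\<close> by simp
    qed
    ultimately show ?thesis by (simp add: quads_def p n_def)
  next
    case B
    define y0 y2 where "y0 = b - g" and "y2 = b + k + 1 - i"
    have y: "y0 + g = b" "y2 + i = b + k + 1" using B a g jm by (auto simp: y0_def y2_def n_def)
    have 1: "(b + (b + k + 1)) mod n = t" by (rule r1) (use y in linarith)
    have 2: "(y0 + y2) mod n = t - j" by (rule r2) (use y g in linarith)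
    have "same_page m (y0 + y2) (b + (b + k + 1))"
      unfolding same_page_def n_def[symmetric] 1 2 using jt by simp
    moreover have "y0 < b" "b < y2" "y2 < b + k + 1" "b + k + 1 < n"
      using B a g jm y n_def by linarith+
    moreover have "decode m p = ((y0, y2), (b, b + k + 1))" unfolding dec using B by (simp add: y0_def y2_def)
    moreover have "t - j < t" using jt a by linarith
    moreover have "encode m ((y0, y2), (b, b + k + 1)) = (k, i, b, j)"
    proof -
      have "b + k + 1 - b \<le> m" "b + k + 1 - b - 1 = k" "b + k + 1 - y2 = i" "i + (b - y0) = j"
        using a y g n_def by linarith+
      then show ?thesis unfolding encode_def n_def[symmetric] Let_def prod.case 1 2
        using \<open>t - j < t\<close> by simp
    qed
    ultimately show ?thesis by (simp add: quads_def p n_def)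
  next
    case C
    define y0 y2 y3 where "y0 = b - g" and "y2 = b + k + 1 - i" and "y3 = b + k + 1 - n"
    have y: "y0 + g = b" "y2 + i = b + k + 1" "y3 + n = b + k + 1" using C a g jm by (auto simp: y0_def y2_def y3_def n_def)
    have 1: "(y3 + b) mod n = t" by (rule r1) (use y in linarith)
    have 2: "(y0 + y2) mod n = t - j" by (rule r2) (use y g in linarith)
    have "same_page m (y3 + b) (y0 + y2)"
      unfolding same_page_def n_def[symmetric] 1 2 using jt by simp
    moreover have "y3 < y0" "y0 < b" "b < y2" "y2 < n"
      using C a g jm y n_def by linarith+
    moreover have "decode m p = ((y3, b), (y0, y2))" unfolding dec using C by (simp add: y0_def y2_def y3_def)
    moreover have "t - j < t" using jt a by linarith
    moreover have "encode m ((y3, b), (y0, y2)) = (k, i, b, j)"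
    proof -
      have "\<not> b - y3 \<le> m" "y3 + n - b - 1 = k" "y3 + n - y2 = i" "i + (b - y0) = j"
        using a y g n_def by linarith+
      then show ?thesis unfolding encode_def n_def[symmetric] Let_def prod.case 1 2
        using \<open>t - j < t\<close> by simp
    qed
    ultimately show ?thesis by (simp add: quads_def p n_def)
  next
    case D
    define y0 y2 y3 where "y0 = b - g" and "y2 = b + k + 1 - i - n" and "y3 = b + k + 1 - n"
    have y: "y0 + g = b" "y2 + i + n = b + k + 1" "y3 + n = b + k + 1" using D a g jm by (auto simp: y0_def y2_def y3_def n_def)
    have 1: "(y3 + b) mod n = t" by (rule r1) (use y in linarith)
    have 2: "(y2 + y0) mod n = t - j" by (rule r2) (use y g in linarith)
    have "same_page m (y2 + y0) (y3 + b)"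
      unfolding same_page_def n_def[symmetric] 1 2 using jt by simp
    moreover have "y2 < y3" "y3 < y0" "y0 < b" "b < n"
      using D a g jm y n_def by linarith+
    moreover have "decode m p = ((y2, y0), (y3, b))" unfolding dec using D by (simp add: y0_def y2_def y3_def)
    moreover have "t - j < t" using jt a by linarith
    moreover have "encode m ((y2, y0), (y3, b)) = (k, i, b, j)"
    proof -
      have "\<not> b - y3 \<le> m" "y3 + n - b - 1 = k" "y3 - y2 = i" "i + (b - y0) = j"
        using a y g n_def by linarith+
      then show ?thesis unfolding encode_def n_def[symmetric] Let_def prod.case 1 2
        using \<open>t - j < t\<close> by simp
    qed
    ultimately show ?thesis by (simp add: quads_def p n_def)
  qed
qed

text \<open>The sum \<open>i + g\<close> is congruent to the larger class minus the smaller one;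
  both numbers lie strictly between 0 and \<open>n\<close>, so they are equal, and the common page
  bounds them by the rank.\<close>

lemma decode_encode:
  assumes "p \<in> quads m"
  shows "encode m p \<in> codes m \<and> decode m (encode m p) = p"
proof -
  obtain x0 x1 x2 x3 where p: "p = ((x0, x2), (x1, x3))" by (cases p) auto
  define n where "n = 2 * m + 1"
  have x: "x0 < x1" "x1 < x2" "x2 < x3" "x3 < n" and page: "same_page m (x0 + x2) (x1 + x3)"
    using assms by (auto simp: p quads_def n_def)
  define A where "A = (x0 + x2) mod n"
  define B where "B = (x1 + x3) mod n"
  have An: "A < n" "B < n" by (simp_all add: A_def B_def n_def)
  have AB: "A < m \<longleftrightarrow> B < m" using page by (simp add: same_page_def A_def B_def n_def)
  have wrap: "y = y mod n \<or> y = y mod n + n" if "y < 2 * n" for y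
    using that le_mod_geq[of n y] by (cases "y < n") auto
  have "x0 + x2 = A \<or> x0 + x2 = A + n" "x1 + x3 = B \<or> x1 + x3 = B + n"
    using x wrap[of "x0 + x2"] wrap[of "x1 + x3"] unfolding A_def B_def by linarith+
  then have j: "x1 + x3 + A = x0 + x2 + B \<or> x1 + x3 + A = x0 + x2 + B + n \<or> x1 + x3 + A + n = x0 + x2 + B"
    by auto
  \<comment> \<open>The sums of the ends differ by \<open>(x1 - x0) + (x3 - x2)\<close>, which is
    positive and less than \<open>n\<close>.\<close>
  have neq: "A \<noteq> B" using j x by auto
  have enc: "encode m p = (if B < A then
       (if x2 - x0 \<le> m then (x2 - x0 - 1, x2 - x1, x0, (x2 - x1) + (x0 + n - x3))
        else (x0 + n - x2 - 1, x0 + n - x3, x2, (x0 + n - x3) + (x2 - x1)))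
     else
       (if x3 - x1 \<le> m then (x3 - x1 - 1, x3 - x2, x1, (x3 - x2) + (x1 - x0))
        else (x1 + n - x3 - 1, x1 - x0, x3, (x1 - x0) + (x3 - x2))))"
    by (simp add: encode_def p Let_def A_def B_def n_def)
  have codes: "(k, i, b, i + g) \<in> codes m"
    if "k < m" "1 \<le> i" "i \<le> k" "b < n" "0 < g" "i + g \<le> page_rank m r" "r = (2 * b + k + 1) mod n" for k i b g r
    using that by (simp add: codes_def n_def)
  have dec: "decode m (k, i, b, i + g) = (if b < g then ((b, b + k + 1), (b + k + 1 - i, b + n - g))
     else if b + k + 1 < n then ((b - g, b + k + 1 - i), (b, b + k + 1))
     else if b + k + 1 - i < n then ((b + k + 1 - n, b), (b - g, b + k + 1 - i))
     else ((b + k + 1 - i - n, b - g), (b + k + 1 - n, b)))" for k i b g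
    by (simp add: decode_def Let_def n_def)
  show ?thesis
  proof (cases "B < A")
    case True
    have rank: "(x2 - x1) + (x0 + n - x3) \<le> page_rank m A"
      using j True AB An x by (auto simp: page_rank_def)
    show ?thesis
    proof (cases "x2 - x0 \<le> m")
      case small: True
      have "A = (2 * x0 + (x2 - x0 - 1) + 1) mod n" unfolding A_def by (rule arg_cong[of _ _ "\<lambda>y. y mod n"]) (use x in linarith)
      then have "(x2 - x0 - 1, x2 - x1, x0, (x2 - x1) + (x0 + n - x3)) \<in> codes m"
        using small x rank by (intro codes) auto
      moreover have "x0 < x0 + n - x3" using x by linarith
      ultimately show ?thesis unfolding enc using True small x
        by (simp only: if_True dec) (simp add: p)
    next
      case big: False
      have "2 * x2 + (x0 + n - x2 - 1) + 1 = x0 + x2 + n" using x by linarith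
      then have "A = (2 * x2 + (x0 + n - x2 - 1) + 1) mod n" unfolding A_def by (metis mod_add_self2)
      then have "(x0 + n - x2 - 1, x0 + n - x3, x2, (x0 + n - x3) + (x2 - x1)) \<in> codes m"
        using big x rank by (intro codes) (auto simp: n_def add.commute)
      moreover have "\<not> x2 < x2 - x1" "\<not> x2 + (x0 + n - x2 - 1) + 1 < n" "x2 + (x0 + n - x2 - 1) + 1 - n = x0"
        "x2 + (x0 + n - x2 - 1) + 1 - (x0 + n - x3) = x3" "x2 - (x2 - x1) = x1"
        using x by linarith+
      ultimately show ?thesis unfolding enc using True big x
        by (simp only: if_True if_False dec) (simp add: p)
    qed
  next
    case False
    have rank: "(x3 - x2) + (x1 - x0) \<le> page_rank m B"
      using j False neq AB An x by (auto simp: page_rank_def)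
    show ?thesis
    proof (cases "x3 - x1 \<le> m")
      case small: True
      have "B = (2 * x1 + (x3 - x1 - 1) + 1) mod n" unfolding B_def by (rule arg_cong[of _ _ "\<lambda>y. y mod n"]) (use x in linarith)
      then have "(x3 - x1 - 1, x3 - x2, x1, (x3 - x2) + (x1 - x0)) \<in> codes m"
        using small x rank by (intro codes) auto
      moreover have "\<not> x1 < x1 - x0" "x1 + (x3 - x1 - 1) + 1 = x3" "x3 - (x3 - x2) = x2" "x1 - (x1 - x0) = x0"
        using x by linarith+
      ultimately show ?thesis unfolding enc using False small x
        by (simp only: if_True if_False dec) (simp add: p)
    next
      case big: False
      have "2 * x3 + (x1 + n - x3 - 1) + 1 = x1 + x3 + n" using x by linarith
      then have "B = (2 * x3 + (x1 + n - x3 - 1) + 1) mod n" unfolding B_def by (metis mod_add_self2)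
      then have "(x1 + n - x3 - 1, x1 - x0, x3, (x1 - x0) + (x3 - x2)) \<in> codes m"
        using big x rank by (intro codes) (auto simp: n_def add.commute)
      moreover have "\<not> x3 < x3 - x2" "\<not> x3 + (x1 + n - x3 - 1) + 1 < n" "x3 + (x1 + n - x3 - 1) + 1 - n = x1"
        "\<not> x3 + (x1 + n - x3 - 1) + 1 - (x1 - x0) < n"
        "x3 + (x1 + n - x3 - 1) + 1 - (x1 - x0) - n = x0" "x3 - (x3 - x2) = x2"
        using x by linarith+
      ultimately show ?thesis unfolding enc using False big x
        by (simp only: if_True if_False dec) (simp add: p)
    qed
  qed
qed

section \<open>Summation over the codes\<close>

lemma card_quads_codes: "card (quads m) = card (codes m)"
proof -
  have "bij_betw (decode m) (codes m) (quads m)"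
    by (rule bij_betw_byWitness[of _ "encode m"]) (use encode_decode decode_encode in auto)
  then show ?thesis by (simp add: bij_betw_same_card)
qed

text \<open>Truncated subtraction discards ranks up to \<open>i\<close>. With
  \<open>d = m - i\<close>, the pages of \<open>m\<close> and \<open>m + 1\<close> classes
  contribute \<open>d * (d - 1) / 2\<close> and \<open>d * (d + 1) / 2\<close>.\<close>

lemma sum_rank:
  assumes "i \<le> m"
  shows "(\<Sum>t<2 * m + 1. page_rank m t - i) = (m - i)\<^sup>2"
proof -
  have tri: "2 * (\<Sum>t<i + d. t - i) = d * (d - 1)" for d
  proof (induction d)
    case (Suc d)
    then show ?case by (cases d) auto
  qed simp
  have "{..<2 * m + 1} = {..<m} \<union> {m..<2 * m + 1}" by auto
  then have "(\<Sum>t<2 * m + 1. page_rank m t - i) = (\<Sum>t<m. page_rank m t - i) + (\<Sum>t=m..<2 * m + 1. page_rank m t - i)"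
    by (simp add: sum.union_disjoint ivl_disj_int)
  also have "(\<Sum>t<m. page_rank m t - i) = (\<Sum>t<m. t - i)" by (simp add: page_rank_def)
  also have "(\<Sum>t=m..<2 * m + 1. page_rank m t - i) = (\<Sum>t<Suc m. t - i)"
    by (rule sum.reindex_bij_witness[of _ "\<lambda>t. t + m" "\<lambda>t. t - m"]) (auto simp: page_rank_def)
  finally have S: "(\<Sum>t<2 * m + 1. page_rank m t - i) = (\<Sum>t<m. t - i) + (\<Sum>t<Suc m. t - i)" .
  obtain d where d: "m = i + d" using assms le_Suc_ex by blast
  have "2 * (\<Sum>t<2 * m + 1. page_rank m t - i) = d * (d - 1) + Suc d * (Suc d - 1)"
    unfolding S using tri[of d] tri[of "Suc d"] by (simp add: d)
  also have "\<dots> = 2 * d\<^sup>2" by (cases d) (auto simp: power2_eq_square)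
  finally show ?thesis by (simp add: d)
qed

text \<open>Doubling permutes the residues modulo an odd number, so each class arises from exactly
  one \<open>b\<close>.\<close>

lemma sum_mod_double:
  fixes f :: "nat \<Rightarrow> nat"
  shows "(\<Sum>b<2 * m + 1. f ((2 * b + c) mod (2 * m + 1))) = (\<Sum>t<2 * m + 1. f t)"
proof -
  define n where "n = 2 * m + 1"
  let ?g = "\<lambda>b. (2 * b + c) mod n"
  have "inj_on ?g {..<n}"
  proof (rule inj_onI)
    fix x y assume xy: "x \<in> {..<n}" "y \<in> {..<n}" "?g x = ?g y"
    then have "int (2 * x + c) mod int n = int (2 * y + c) mod int n" by (metis of_nat_mod)
    then have "int n dvd 2 * (int x - int y)" by (simp add: mod_eq_dvd_iff algebra_simps)
    moreover have "coprime (int n) 2" by (simp add: n_def)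
    ultimately have "int n dvd int x - int y" using coprime_dvd_mult_right_iff by blast
    then have "int x mod int n = int y mod int n" by (simp add: mod_eq_dvd_iff)
    then show "x = y" using xy by simp
  qed
  moreover have "?g ` {..<n} \<subseteq> {..<n}" by (auto simp: n_def)
  ultimately have "bij_betw ?g {..<n} {..<n}"
    by (simp add: bij_betw_def endo_inj_surj)
  then show ?thesis unfolding n_def[symmetric] by (rule sum.reindex_bij_betw)
qed

text \<open>After exchanging the sums, \<open>h i\<close> occurs once for each \<open>k\<close> with
  \<open>i \<le> k < M\<close>.\<close>

lemma sum_triangle:
  fixes h :: "nat \<Rightarrow> nat"
  shows "(\<Sum>k<M. \<Sum>i\<in>{1..k}. h i) = (\<Sum>i\<in>{1..<M}. (M - i) * h i)"
proof (induction M)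
  case (Suc M)
  have "(\<Sum>i\<in>{1..<Suc M}. (Suc M - i) * h i) = (\<Sum>i\<in>{1..M}. (M - i) * h i + h i)"
    by (rule sum.cong) (auto simp: Suc_diff_le)
  also have "\<dots> = (\<Sum>i\<in>{1..M}. (M - i) * h i) + (\<Sum>i\<in>{1..M}. h i)" by (rule sum.distrib)
  also have "(\<Sum>i\<in>{1..M}. (M - i) * h i) = (\<Sum>i\<in>{1..<M}. (M - i) * h i)"
    by (cases M) (auto simp: atLeastLessThanSuc_atLeastAtMost[symmetric])
  finally show ?case using Suc.IH by simp
qed simp

lemma sum_cubes: "4 * (\<Sum>i<m. i ^ 3) = (m * (m - 1))\<^sup>2" for m :: nat
proof (induction m)
  case (Suc m)
  then show ?case by (cases m) (auto simp: power2_eq_square power3_eq_cube algebra_simps)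
qed simp

lemma card_codes: "card (codes m) = (\<Sum>i<m. i ^ 3)"
proof -
  have "card (codes m) = (\<Sum>k<m. \<Sum>i\<in>{1..k}. \<Sum>b<2 * m + 1. page_rank m ((2 * b + (k + 1)) mod (2 * m + 1)) - i)"
    unfolding codes_def by (simp add: add.assoc)
  also have "\<dots> = (\<Sum>k<m. \<Sum>i\<in>{1..k}. \<Sum>t<2 * m + 1. page_rank m t - i)"
    by (intro sum.cong refl sum_mod_double)
  also have "\<dots> = (\<Sum>k<m. \<Sum>i\<in>{1..k}. (m - i)\<^sup>2)"
    by (intro sum.cong refl sum_rank) auto
  also have "\<dots> = (\<Sum>i\<in>{1..<m}. (m - i) * (m - i)\<^sup>2)" by (rule sum_triangle)
  also have "\<dots> = (\<Sum>i\<in>{1..<m}. i ^ 3)"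
    by (rule sum.reindex_bij_witness[of _ "\<lambda>i. m - i" "\<lambda>i. m - i"]) (auto simp: power2_eq_square power3_eq_cube)
  also have "\<dots> = (\<Sum>i<m. i ^ 3)"
    by (rule sum.mono_neutral_left) (auto simp: not_le)
  finally show ?thesis .
qed

lemma card_quads: "card (quads m) = Z (2 * m + 1)"
proof -
  have "Z (2 * m + 1) = (m * (m - 1))\<^sup>2 div 4"
    by (cases m) (auto simp: Z_def power2_eq_square algebra_simps)
  then show ?thesis unfolding card_quads_codes card_codes sum_cubes[symmetric] by simp
qed

section \<open>The effect of the rerouting\<close>

lemma page_neg: "k + l < 2 * m + 1 \<Longrightarrow> page m (k, l) = - 1 \<longleftrightarrow> k + l < m"
  by (simp add: page_def)

lemma page_neg_wrap:
  assumes "2 * m + 1 \<le> k + l" "k \<le> 2 * m" "l \<le> 2 * m"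
  shows "page m (k, l) = - 1 \<longleftrightarrow> k + l < 3 * m + 1"
proof -
  have "(k + l) mod (2 * m + 1) = k + l - (2 * m + 1)"
    using assms le_mod_geq[of "2 * m + 1" "k + l"] by simp
  then show ?thesis using assms by (auto simp: page_def)
qed

lemma page_pos_iff: "page m a = 1 \<longleftrightarrow> page m a \<noteq> - 1"
  by (simp add: page_def)

lemma page_eq_iff: "page m a = page m b \<longleftrightarrow> same_page m (fst a + snd a) (fst b + snd b)"
  by (auto simp: page_def same_page_def)

lemma same_page_commute: "same_page m x y \<longleftrightarrow> same_page m y x"
  by (auto simp: same_page_def)

text \<open>The lower half of the rerouted edge cuts off only the vertex \<open>m + 1\<close>, the
  upper half the vertices from 1 to \<open>m + 1\<close>. Hence edges from \<open>m + 1\<close> to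
  larger vertices cross it on whichever page they lie.\<close>

definition detour_crossers :: "nat \<Rightarrow> (nat \<times> nat) set" where
  "detour_crossers m = {(k, l). k < l \<and> l < 2 * m + 1 \<and>
     (page m (k, l) = - 1 \<and> k = m + 1 \<or> page m (k, l) = 1 \<and> 0 < k \<and> k \<le> m + 1 \<and> m + 1 < l)}"

lemma crossing_pairs_piece:
  assumes m: "3 \<le> m"
  shows "(s, a, b) \<in> crossing_pairs (2 * m + 1) (piece m) \<longleftrightarrow>
    s = page m b \<and> (if a = (0, m) then b \<in> detour_crossers m else (a, b) \<in> quads m)"
proof -
  obtain i j k l where ab: "a = (i, j)" "b = (k, l)" by (cases a, cases b)
  consider "b = (0, m)" | "a = (0, m)" "b \<noteq> (0, m)" | "a \<noteq> (0, m)" "b \<noteq> (0, m)" by blast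
  then show ?thesis
  proof cases
    case 1
    \<comment> \<open>An edge could precede the rerouted one in a pair only by ending at
      \<open>m + 1\<close> on the lower page from a vertex below \<open>m\<close>, but such a sum of
      ends lies between \<open>m + 1\<close> and \<open>2 * m\<close>, on the upper page.\<close>
    have "\<not> (2 * i < 2 * m \<and> 2 * m < 2 * j \<and> 2 * j < 2 * m + 3 \<and> page m (i, j) = - 1)"
    proof
      assume *: "2 * i < 2 * m \<and> 2 * m < 2 * j \<and> 2 * j < 2 * m + 3 \<and> page m (i, j) = - 1"
      then have "j = m + 1" by linarith
      then show False using * page_neg[of i j m] by auto
    qed
    then show ?thesis using 1 m
      by (auto simp: crossing_pairs_def ab piece_def interleaved_def quads_def detour_crossers_def)
  next
    case 2
    then show ?thesis using m
      by (auto simp: crossing_pairs_def ab piece_def interleaved_def detour_crossers_def Kedges_def page_pos_iff)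
  next
    case 3
    then show ?thesis
      by (auto simp: crossing_pairs_def ab piece_def interleaved_def quads_def Kedges_def page_eq_iff same_page_commute)
  qed
qed

text \<open>The rerouting trades the crossings with \<open>(k, m + 1)\<close> for
  \<open>0 < k < m\<close> against those with \<open>(m + 1, l)\<close> for
  \<open>m + 1 < l \<le> 2 * m\<close>, which are \<open>m - 1\<close> each; the other crossings of
  the edge are the same.\<close>

lemma card_detour_crossers:
  assumes m: "3 \<le> m"
  shows "card (detour_crossers m) = card {b. ((0, m), b) \<in> quads m}"
proof -
  have O: "{b. ((0, m), b) \<in> quads m} = {(k, l). 0 < k \<and> k < m \<and> m < l \<and> k + l \<le> 2 * m}" (is "_ = ?O")
  proof (rule set_eqI)
    fix b :: "nat \<times> nat"
    obtain k l where b: "b = (k, l)" by (cases b)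
    have "page m (k, l) = page m (0, m) \<longleftrightarrow> k + l \<le> 2 * m" if "0 < k" "k < m" "m < l" "l \<le> 2 * m"
    proof (cases "k + l < 2 * m + 1")
      case True
      then show ?thesis using that page_neg[of k l m] page_neg[of 0 m m] by (auto simp: page_pos_iff page_def)
    next
      case False
      then show ?thesis using that page_neg_wrap[of m k l] page_neg[of 0 m m] by (auto simp: page_def)
    qed
    then have *: "same_page m m (k + l) \<longleftrightarrow> k + l \<le> 2 * m" if "0 < k" "k < m" "m < l" "l \<le> 2 * m"
      using that by (auto simp: page_eq_iff same_page_def)
    show "b \<in> {b. ((0, m), b) \<in> quads m} \<longleftrightarrow> b \<in> ?O"
      using * by (auto simp: b quads_def)
  qed
  have N: "detour_crossers m = {(k, l). 0 < k \<and> m + 1 < l \<and> (k = m + 1 \<and> l \<le> 2 * m \<or> k + l \<le> 2 * m)}" (is "_ = ?N")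
  proof (rule set_eqI)
    fix b :: "nat \<times> nat"
    obtain k l where b: "b = (k, l)" by (cases b)
    have "page m (k, l) = 1 \<longleftrightarrow> k + l \<le> 2 * m" if "0 < k" "k \<le> m" "m + 1 < l" "l \<le> 2 * m"
      using that page_neg[of k l m] page_neg_wrap[of m k l] by (cases "k + l < 2 * m + 1") (auto simp: page_pos_iff)
    then show "b \<in> detour_crossers m \<longleftrightarrow> b \<in> ?N"
      using m by (cases "k = m + 1") (auto simp: b detour_crossers_def page_pos_iff)
  qed
  let ?f = "\<lambda>(k, l). if k = m + 1 then (l - (m + 1), m + 1) else (k, l)"
  let ?g = "\<lambda>(k, l). if l = m + 1 then (m + 1, k + (m + 1)) else (k, l)"
  have "bij_betw ?f ?N ?O"
    by (rule bij_betw_byWitness[of _ ?g]) (use m in \<open>auto split: if_splits\<close>)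
  then show ?thesis unfolding O N by (rule bij_betw_same_card)
qed

lemma finite_quads: "finite (quads m)"
  by (rule finite_subset[of _ "({..2 * m} \<times> {..2 * m}) \<times> ({..2 * m} \<times> {..2 * m})"]) (auto simp: quads_def)

lemma card_crossing_pairs_piece:
  assumes m: "3 \<le> m"
  shows "card (crossing_pairs (2 * m + 1) (piece m)) = Z (2 * m + 1)"
proof -
  let ?e = "(0 :: nat, m)"
  define S where "S = {ab \<in> quads m. fst ab \<noteq> ?e}"
  have quads: "quads m = S \<union> {?e} \<times> {b. (?e, b) \<in> quads m}" by (auto simp: S_def)
  have "{b. (?e, b) \<in> quads m} \<subseteq> snd ` quads m" by force
  then have fin: "finite S" "finite {b. (?e, b) \<in> quads m}"
    using finite_quads[of m] by (auto simp: S_def intro: finite_subset)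
  have fin2: "finite (detour_crossers m)"
    by (rule finite_subset[of _ "{..2 * m} \<times> {..2 * m}"]) (auto simp: detour_crossers_def)
  have "crossing_pairs (2 * m + 1) (piece m) = (\<lambda>(a, b). (page m b, a, b)) ` (S \<union> {?e} \<times> detour_crossers m)" (is "_ = ?h ` ?T")
  proof (rule set_eqI)
    fix x :: "real \<times> (nat \<times> nat) \<times> (nat \<times> nat)"
    obtain s a b where x: "x = (s, a, b)" by (cases x) auto
    have "x \<in> ?h ` ?T \<longleftrightarrow> s = page m b \<and> (a, b) \<in> ?T" unfolding x
      by (auto intro: image_eqI[of _ _ "(a, b)"])
    then show "x \<in> crossing_pairs (2 * m + 1) (piece m) \<longleftrightarrow> x \<in> ?h ` ?T"
      unfolding x crossing_pairs_piece[OF m] by (auto simp: S_def)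
  qed
  moreover have "inj_on ?h ?T" by (auto simp: inj_on_def)
  ultimately have "card (crossing_pairs (2 * m + 1) (piece m)) = card ?T" by (simp add: card_image)
  also have "\<dots> = card S + card ({?e} \<times> detour_crossers m)"
    by (rule card_Un_disjoint) (use fin fin2 in \<open>auto simp: S_def\<close>)
  also have "\<dots> = card S + card ({?e} \<times> {b. (?e, b) \<in> quads m})"
    using card_detour_crossers[OF m] by (simp add: card_cartesian_product)
  also have "\<dots> = card (S \<union> {?e} \<times> {b. (?e, b) \<in> quads m})"
    by (rule card_Un_disjoint[symmetric]) (use fin in \<open>auto simp: S_def\<close>)
  finally show ?thesis unfolding quads[symmetric] card_quads .
qed

section \<open>Hamiltonian cycles\<close>

lemma uedge_commute: "uedge i j = uedge j i"
  by (simp add: uedge_def min.commute max.commute)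

lemma cycle_edges_nth:
  assumes "i < length cs"
  shows "uedge (cs ! i) (cs ! (Suc i mod length cs)) \<in> cycle_edges cs"
proof (cases "Suc i < length cs")
  case True
  then show ?thesis by (auto simp: cycle_edges_def path_edges_def)
next
  case False
  then have "Suc i = length cs" using assms by simp
  then have "length cs - 1 = i" "Suc i mod length cs = 0" "cs \<noteq> []" by auto
  then have "last cs = cs ! i" "cs ! (Suc i mod length cs) = hd cs"
    by (simp_all add: last_conv_nth hd_conv_nth)
  then show ?thesis by (simp add: cycle_edges_def)
qed

lemma cycle_two_neighbours:
  assumes cs: "ham_path n cs" and n: "3 \<le> n" and v: "v < n"
  obtains u w where "u < n" "w < n" "u \<noteq> v" "w \<noteq> v" "u \<noteq> w" "uedge v u \<in> cycle_edges cs" "uedge v w \<in> cycle_edges cs"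
proof -
  have d: "distinct cs" and s: "set cs = {..<n}" using cs by (auto simp: ham_path_def)
  have len: "length cs = n" using distinct_card[OF d] s by simp
  obtain i where i: "i < n" "v = cs ! i" using v s len by (metis in_set_conv_nth lessThan_iff)
  define i' where "i' = (if Suc i = n then 0 else Suc i)"
  define i'' where "i'' = (if i = 0 then n - 1 else i - 1)"
  have i': "i' < n" "Suc i mod n = i'" "i' \<noteq> i" using i n by (auto simp: i'_def)
  have i'': "i'' < n" "Suc i'' mod n = i" "i'' \<noteq> i" "i'' \<noteq> i'" using i n by (auto simp: i''_def i'_def)
  show thesis
  proof
    show "cs ! i' < n" "cs ! i'' < n" using s len i' i'' by (metis lessThan_iff nth_mem)+
    show "cs ! i' \<noteq> v" "cs ! i'' \<noteq> v" "cs ! i' \<noteq> cs ! i''"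
      using d len i i' i'' by (auto simp: nth_eq_iff_index_eq)
    show "uedge v (cs ! i') \<in> cycle_edges cs" using cycle_edges_nth[of i cs] len i i' by simp
    show "uedge v (cs ! i'') \<in> cycle_edges cs" using cycle_edges_nth[of i'' cs] len i i'' by (simp add: uedge_commute)
  qed
qed

text \<open>An independent set has at most one vertex on each of the seven edges. Adding the seven
  inequalities counts every vertex twice, and 8 exceeds 7.\<close>

lemma cycle_7_not_independent:
  assumes cs: "ham_path 7 cs" and I: "I \<subseteq> {..<7}" "card I = 4"
  obtains u v where "u \<in> I" "v \<in> I" "u \<noteq> v" "uedge u v \<in> cycle_edges cs"
proof (rule ccontr)
  assume "\<not> thesis"
  with that have no: "\<not> (u \<in> I \<and> v \<in> I)" if "u \<noteq> v" "uedge u v \<in> cycle_edges cs" for u v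
    using that by blast
  have d: "distinct cs" and s: "set cs = {..<7}" using cs by (auto simp: ham_path_def)
  have len: "length cs = 7" using distinct_card[OF d] s by simp
  define f :: "nat \<Rightarrow> nat" where "f i = (if cs ! i \<in> I then 1 else 0)" for i
  have le: "f i + f j \<le> 1" if "i < 7" "j = (i + 1) mod 7" for i j
  proof -
    have "Suc i mod 7 \<noteq> i" "Suc i mod 7 < 7" using that by (auto simp: mod_Suc)
    then have "cs ! i \<noteq> cs ! (Suc i mod 7)" using d len that by (simp add: nth_eq_iff_index_eq)
    then show ?thesis using no[OF _ cycle_edges_nth[of i cs, unfolded len, OF that(1)]] that(2) by (auto simp: f_def)
  qed
  have "bij_betw ((!) cs) {..<7} {..<7}" using bij_betw_nth[OF d] len s by simp
  then have "(\<Sum>i<7. f i) = (\<Sum>x<7. if x \<in> I then 1 else 0)"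
    unfolding f_def by (rule sum.reindex_bij_betw)
  also have "\<dots> = card ({..<7} \<inter> I)" by (simp add: sum.If_cases)
  also have "{..<7} \<inter> I = I" using I by blast
  finally have "(\<Sum>i<7. f i) = 4" using I by simp
  moreover have "(\<Sum>i<7. f i) = f 0 + f 1 + f 2 + f 3 + f 4 + f 5 + f 6" by (simp add: eval_nat_numeral)
  moreover have "f 0 + f 1 \<le> 1" "f 1 + f 2 \<le> 1" "f 2 + f 3 \<le> 1" "f 3 + f 4 \<le> 1"
    "f 4 + f 5 \<le> 1" "f 5 + f 6 \<le> 1" "f 6 + f 0 \<le> 1"
    by (rule le; simp)+
  ultimately show False by linarith
qed

section \<open>The free path and the absence of a free cycle\<close>

lemma same_page_high: "m \<le> x \<Longrightarrow> x \<le> 2 * m \<Longrightarrow> m \<le> y \<Longrightarrow> y \<le> 2 * m \<Longrightarrow> same_page m x y"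
  by (simp add: same_page_def)

theorem theorem1p1:
  fixes n :: nat
  assumes "odd n" and "7 \<le> n"
  shows "\<exists>D ps. is_diagram n D \<and> crossing_number n D = Z n \<and>
           ham_path n ps \<and> (\<forall>a \<in> path_edges ps. \<not> edge_has_crossing n D a) \<and>
           \<not> (\<exists>cs. free_ham_cycle n D cs)"
proof -
  obtain m where n: "n = 2 * m + 1" using \<open>odd n\<close> by (elim oddE)
  have m: "3 \<le> m" using \<open>7 \<le> n\<close> n by simp
  obtain t :: "nat \<Rightarrow> real" where "\<And>i j. i < j \<Longrightarrow> j < 4 * m + 1 \<Longrightarrow> t i < t j"
    and "\<And>a b c d e f. distinct [a, b, c, d, e, f] \<Longrightarrow> {a, b, c, d, e, f} \<subseteq> {..<4 * m + 1} \<Longrightarrow>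
        concur (t a) (t b) (t c) (t d) (t e) (t f) \<noteq> 0"
    using generic_sequence[of "4 * m + 1"] by blast
  then interpret lifted_drawing n "4 * m + 1" "drawing m t" t "piece m"
    unfolding n using m by (intro lifted_drawing_drawing)
  let ?D = "drawing m t"
  have crossed: "edge_has_crossing n ?D a \<longleftrightarrow>
      (\<exists>b. (if a = (0, m) then b \<in> detour_crossers m else (a, b) \<in> quads m) \<or>
           (if b = (0, m) then a \<in> detour_crossers m else (b, a) \<in> quads m))"
    if "a \<in> Kedges n" for a
    unfolding edge_has_crossing_iff[OF that] unfolding n crossing_pairs_piece[OF m] by blast
  \<comment> \<open>Crossings that do not involve the rerouted edge survive; \<open>(0, m)\<close>
    is never the second edge of a member of \<open>quads\<close>, since that edge starts above
    0.\<close>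
  have crossed1: "edge_has_crossing n ?D a" if "(a, b) \<in> quads m" "a \<noteq> (0, m)" for a b
    using that crossed[of a] by (auto simp: quads_def Kedges_def n)
  have crossed2: "edge_has_crossing n ?D b" if "(a, b) \<in> quads m" "a \<noteq> (0, m)" for a b
  proof -
    have "b \<in> Kedges n" using that by (auto simp: quads_def Kedges_def n)
    then show ?thesis unfolding crossed[OF \<open>b \<in> Kedges n\<close>] using that by metis
  qed
  have crossed3: "edge_has_crossing n ?D (m + 1, y)" if "m + 2 \<le> y" "y < n" for y
    using that crossed[of "(m + 1, y)"] by (auto simp: detour_crossers_def Kedges_def n page_pos_iff)

  \<comment> \<open>The path is \<open>m + 1, m, ..., 0, 2 * m, ..., m + 2\<close>: once round the
    equator without the edge \<open>(m + 1, m + 2)\<close>.\<close>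
  define h where "h k = (if k \<le> m + 1 then m + 1 - k else 3 * m + 2 - k)" for k
  define ps where "ps = map h [0..<n]"
  have "h ` {0..<n} = {..<n}"
  proof (intro equalityI subsetI)
    fix y assume "y \<in> {..<n}"
    \<comment> \<open>\<open>h\<close> is an involution, so \<open>h y\<close> is the required
      preimage.\<close>
    then have "h (if y \<le> m + 1 then m + 1 - y else 3 * m + 2 - y) = y"
      "(if y \<le> m + 1 then m + 1 - y else 3 * m + 2 - y) < n" using m by (auto simp: h_def n)
    then show "y \<in> h ` {0..<n}" by (metis atLeastLessThan_iff image_eqI zero_le)
  qed (use m in \<open>auto simp: h_def n\<close>)
  moreover have "inj_on h {0..<n}" by (auto simp: inj_on_def h_def n split: if_splits)
  ultimately have path: "ham_path n ps" by (simp add: ham_path_def ps_def distinct_map)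
  have "\<not> edge_has_crossing n ?D a" if edge: "a \<in> path_edges ps" for a
  proof -
    have ps: "length ps = n" "\<And>k. k < n \<Longrightarrow> ps ! k = h k" by (simp_all add: ps_def)
    obtain k where "Suc k < length ps" "a = uedge (ps ! k) (ps ! Suc k)"
      using edge by (auto simp: path_edges_def)
    then have k: "Suc k < n" "a = uedge (h k) (h (Suc k))" by (simp_all add: ps)
    have "a = (0, 2 * m) \<or> (\<exists>i. a = (i, Suc i) \<and> i < 2 * m \<and> i \<noteq> m + 1)"
      using k m by (auto simp: h_def uedge_def n)
    then show ?thesis
    proof
      assume a: "a = (0, 2 * m)"
      then have "a \<in> Kedges n" using m by (simp add: Kedges_def n)
      then show ?thesis using a m by (auto simp: crossed quads_def detour_crossers_def)
    next
      assume "\<exists>i. a = (i, Suc i) \<and> i < 2 * m \<and> i \<noteq> m + 1"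
      then obtain i where a: "a = (i, Suc i)" "i < 2 * m" "i \<noteq> m + 1" by blast
      then have "a \<in> Kedges n" by (simp add: Kedges_def n)
      then show ?thesis using a m by (auto simp: crossed quads_def detour_crossers_def)
    qed
  qed
  moreover have "\<not> free_ham_cycle n ?D cs" for cs
  proof
    assume "free_ham_cycle n ?D cs"
    then have cs: "ham_path n cs" and free: "\<And>a. a \<in> cycle_edges cs \<Longrightarrow> \<not> edge_has_crossing n ?D a"
      by (auto simp: free_ham_cycle_def)
    show False
    proof (cases "m = 3")
      case True
      \<comment> \<open>Five of the six pairs keep a crossing with an edge that is not rerouted;
        \<open>(4, 5)\<close> is crossed by the detour.\<close>
      have "card {0, 2, 4, 5 :: nat} = 4" "{0, 2, 4, 5} \<subseteq> {..<7 :: nat}" by auto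
      then obtain u v :: nat where uv: "u \<in> {0, 2, 4, 5}" "v \<in> {0, 2, 4, 5}" "u \<noteq> v" "uedge u v \<in> cycle_edges cs"
        using cycle_7_not_independent[of cs "{0, 2, 4, 5}"] cs True n by auto
      have "edge_has_crossing n ?D (0, 2)" by (rule crossed1[of _ "(1, 6)"]) (simp_all add: quads_def same_page_def True)
      moreover have "edge_has_crossing n ?D (0, 4)" by (rule crossed1[of _ "(1, 5)"]) (simp_all add: quads_def same_page_def True)
      moreover have "edge_has_crossing n ?D (0, 5)" by (rule crossed1[of _ "(4, 6)"]) (simp_all add: quads_def same_page_def True)
      moreover have "edge_has_crossing n ?D (2, 4)" by (rule crossed2[of "(1, 3)"]) (simp_all add: quads_def same_page_def True)
      moreover have "edge_has_crossing n ?D (2, 5)" by (rule crossed1[of _ "(3, 6)"]) (simp_all add: quads_def same_page_def True)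
      moreover have "edge_has_crossing n ?D (4, 5)" using crossed3[of 5] by (simp add: True n)
      ultimately show False using free[OF uv(4)] uv(1-3) by (auto simp: uedge_def)
    next
      case False
      then have m4: "4 \<le> m" using m by simp
      have leaf: "edge_has_crossing n ?D (uedge (m + 1) y)" if y: "y < n" "y \<noteq> m" "y \<noteq> m + 1" for y
      proof -
        consider "m + 2 \<le> y" | "y = 0" | "y = 1" | "2 \<le> y" "y < m" using y by linarith
        then show ?thesis
        proof cases
          case 1
          then show ?thesis using crossed3[of y] y by (simp add: uedge_def)
        next
          case 2
          have "((0, m + 1), (1, m + 2)) \<in> quads m" using m by (auto simp: quads_def intro!: same_page_high)
          then show ?thesis using crossed1 2 by (simp add: uedge_def)
        next
          case 3
          \<comment> \<open>Here \<open>m \<ge> 4\<close> is used: the sum \<open>m + 4\<close> must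
            not exceed \<open>2 * m\<close> for the second edge to be on the upper page.\<close>
          have "((1, m + 1), (2, m + 2)) \<in> quads m" using m4 by (auto simp: quads_def intro!: same_page_high)
          then show ?thesis using crossed1 3 by (simp add: uedge_def)
        next
          case 4
          have "((1, m), (y, m + 1)) \<in> quads m" using 4 by (auto simp: quads_def intro!: same_page_high)
          then show ?thesis using crossed2 4 by (fastforce simp: uedge_def)
        qed
      qed
      obtain u w where uw: "u < n" "w < n" "u \<noteq> m + 1" "w \<noteq> m + 1" "u \<noteq> w"
        "uedge (m + 1) u \<in> cycle_edges cs" "uedge (m + 1) w \<in> cycle_edges cs"
        using cycle_two_neighbours[OF cs, of "m + 1"] m n by auto
      \<comment> \<open>The only edge at \<open>m + 1\<close> that can be free leads to
        \<open>m\<close>, while a cycle needs two.\<close>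
      then have "u = m" "w = m" using leaf free by blast+
      then show False using uw by simp
    qed
  qed
  moreover have "crossing_number n ?D = Z n"
    unfolding crossing_number unfolding n by (rule card_crossing_pairs_piece[OF m])
  ultimately show ?thesis using is_diagram path by blast
qed

end
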